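(* Let $V_0,V_2$ be real functions of $r$ and $$H=-\frac{\hbar^2}{2}\nabla^2+V_0(r)+\frac{\hbar}{2r^2}(\vec\sigma_1+\vec\sigma_2,\vec L)+V_2(r)(\vec\sigma_1,\vec\sigma_2).$$ Define the integrals of motion of $H$ $$K=(\vec\sigma_1,\vec\sigma_2),\qquad A=(\vec\sigma_1+\vec\sigma_2,\vec L),\qquad Y_P^8=\frac1r(\vec\sigma_1+\vec\sigma_2,\vec x),$$ $$Y_P^9=-\frac1r\left[(\vec\sigma_1,\vec x)(\vec\sigma_2,\vec L)+(\vec\sigma_2,\vec x)(\vec\sigma_1,\vec L)\right],$$ $$Y_P^{10}=\frac1r(\vec\sigma_1+\vec\sigma_2,\vec x)(\vec x,\vec p)-r(\vec\sigma_1+\vec\sigma_2,\vec p)-\frac{i\hbar}{r}(\vec\sigma_1+\vec\sigma_2,\vec x).$$ Then $A,Y_P^8,Y_P^{10}$, together with the central elements $K$ and $\vec J^2$, generate a finite quadratic polynomial algebra. More precisely, $$[K,A]=[K,Y_P^8]=[K,Y_P^{10}]=[K,\vec J^2]=0,\qquad [\vec J^2,A]=[\vec J^2,Y_P^8]=[\vec J^2,Y_P^{10}]=0;$$ the operator $Y_P^9$ is not independent but satisfies $$Y_P^9=-Y_P^8A+iY_P^{10}-\hbar Y_P^8;$$ and the remaining non-trivial commutation relations are $$[A,Y_P^8]=-2iY_P^{10},$$ $$[Y_P^8,Y_P^{10}]=-2iA-i\hbar\left(6+2K-(Y_P^8)^2\right),$$ $$[A,Y_P^{10}]=2iY_P^8\vec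 L^2-2\hbar Y_P^{10},$$ where $\vec L^2=\vec J^2-\hbar A-\frac{\hbar^2}{4}(6+2K)$. Hence the algebra closes quadratically on $A,Y_P^8,Y_P^{10}$, with $K$ and $\vec J^2$ as central elements.
   Context: $\vec x\in\mathbb R^3\setminus\{0\}$, $r=|\vec x|$, $p_k=-i\hbar\,\partial/\partial x_k$ with $\hbar>0$, $\vec L=\vec x\times\vec p$, $(\cdot,\cdot)$ is the Euclidean inner product; $\vec\sigma$ is the vector of Pauli matrices, $\vec\sigma_1=\vec\sigma\otimes I_2$, $\vec\sigma_2=I_2\otimes\vec\sigma$, $\vec J=\vec L+\frac\hbar2(\vec\sigma_1+\vec\sigma_2)$. Operators act on smooth $\mathbb C^4$-valued functions on $\mathbb R^3\setminus\{0\}$; products are in the order written. An integral of motion is an operator commuting with $H$. "Closes quadratically" means that commutators of the generators are polynomials of degree at most two in them, with coefficients polynomial in the central elements $K,\vec J^2$. *)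

theory Defs
  imports "HOL-Analysis.Analysis" "HOL-Library.Function_Algebras"
begin

text \<open>For open \<open>S\<close>: all iterated directional derivatives up to order \<open>n\<close> exist and are continuous.\<close>

primrec Ck_on :: "nat \<Rightarrow> 'a::euclidean_space set \<Rightarrow> ('a \<Rightarrow> 'b::real_normed_vector) \<Rightarrow> bool" where
  "Ck_on 0 S f \<longleftrightarrow> continuous_on S f"
| "Ck_on (Suc n) S f \<longleftrightarrow>
     (\<forall>x\<in>S. f differentiable (at x)) \<and> (\<forall>v. Ck_on n S (\<lambda>x. frechet_derivative f (at x) v))"

definition smooth_on :: "'a::euclidean_space set \<Rightarrow> ('a \<Rightarrow> 'b::real_normed_vector) \<Rightarrow> bool" where
  "smooth_on S f \<longleftrightarrow> (\<forall>n. Ck_on n S f)"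

text \<open>The space \<open>\<complex>\<^sup>4 = \<complex>\<^sup>2 \<otimes> \<complex>\<^sup>2\<close> has the index type \<open>2 \<times> 2\<close>.  Fields are total functions
  whose value at the origin is junk: all operators below are local on the complement
  of the origin, and operators are compared only there, on smooth fields (\<open>op_eq\<close>).
  Sums and differences of operators are pointwise, and their product is composition.\<close>

type_synonym spinor = "complex ^ (2 \<times> 2)"
type_synonym spinor_field = "real ^ 3 \<Rightarrow> spinor"
type_synonym spinor_op = "spinor_field \<Rightarrow> spinor_field"

definition op_eq :: "spinor_op \<Rightarrow> spinor_op \<Rightarrow> bool" (infix "\<doteq>" 50) where
  "T \<doteq> U \<longleftrightarrow> (\<forall>\<psi>. smooth_on (- {0}) \<psi> \<longrightarrow> (\<forall>x. x \<noteq> 0 \<longrightarrow> T \<psi> x = U \<psi> x))"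

abbreviation op_prod :: "spinor_op \<Rightarrow> spinor_op \<Rightarrow> spinor_op" (infixl "\<odot>" 70) where
  "T \<odot> U \<equiv> T \<circ> U"

definition op_scale :: "complex \<Rightarrow> spinor_op \<Rightarrow> spinor_op" (infixr "\<cdot>" 75) where
  "c \<cdot> T = (\<lambda>\<psi> x. c *s T \<psi> x)"

definition commutator :: "spinor_op \<Rightarrow> spinor_op \<Rightarrow> spinor_op" where
  "commutator T U = T \<odot> U - U \<odot> T"

definition mult_op :: "(real ^ 3 \<Rightarrow> real) \<Rightarrow> spinor_op" where
  "mult_op f = (\<lambda>\<psi> x. f x *\<^sub>R \<psi> x)"

definition matrix_op :: "complex ^ (2 \<times> 2) ^ (2 \<times> 2) \<Rightarrow> spinor_op" where
  "matrix_op M = (\<lambda>\<psi> x. M *v \<psi> x)"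

definition partial :: "3 \<Rightarrow> spinor_op" where
  "partial k = (\<lambda>\<psi> x. frechet_derivative \<psi> (at x) (axis k 1))"

definition op_inner :: "(3 \<Rightarrow> spinor_op) \<Rightarrow> (3 \<Rightarrow> spinor_op) \<Rightarrow> spinor_op" where
  "op_inner X Y = (\<Sum>k\<in>UNIV. X k \<odot> Y k)"

definition op_cross :: "(3 \<Rightarrow> spinor_op) \<Rightarrow> (3 \<Rightarrow> spinor_op) \<Rightarrow> 3 \<Rightarrow> spinor_op" where
  "op_cross X Y k =
     (if k = 1 then X 2 \<odot> Y 3 - X 3 \<odot> Y 2
      else if k = 2 then X 3 \<odot> Y 1 - X 1 \<odot> Y 3
      else X 1 \<odot> Y 2 - X 2 \<odot> Y 1)"

definition pauli :: "3 \<Rightarrow> complex ^ 2 ^ 2" where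
  "pauli k =
     (if k = 1 then vector [vector [0, 1], vector [1, 0]]
      else if k = 2 then vector [vector [0, - \<i>], vector [\<i>, 0]]
      else vector [vector [1, 0], vector [0, - 1]])"

definition kronecker :: "complex ^ 2 ^ 2 \<Rightarrow> complex ^ 2 ^ 2 \<Rightarrow> complex ^ (2 \<times> 2) ^ (2 \<times> 2)" where
  "kronecker M N = (\<chi> i j. M $ fst i $ fst j * N $ snd i $ snd j)"

definition sigma1 :: "3 \<Rightarrow> spinor_op" where
  "sigma1 k = matrix_op (kronecker (pauli k) (mat 1))"

definition sigma2 :: "3 \<Rightarrow> spinor_op" where
  "sigma2 k = matrix_op (kronecker (mat 1) (pauli k))"

definition pos :: "3 \<Rightarrow> spinor_op" where
  "pos k = mult_op (\<lambda>x. x $ k)"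

definition mom :: "real \<Rightarrow> 3 \<Rightarrow> spinor_op" where
  "mom hbar k = (- \<i> * of_real hbar) \<cdot> partial k"

definition ang :: "real \<Rightarrow> 3 \<Rightarrow> spinor_op" where
  "ang hbar = op_cross pos (mom hbar)"

definition tot_ang :: "real \<Rightarrow> 3 \<Rightarrow> spinor_op" where
  "tot_ang hbar k = ang hbar k + of_real (hbar / 2) \<cdot> (sigma1 k + sigma2 k)"

definition op_L2 :: "real \<Rightarrow> spinor_op" where
  "op_L2 hbar = op_inner (ang hbar) (ang hbar)"

definition op_J2 :: "real \<Rightarrow> spinor_op" where
  "op_J2 hbar = op_inner (tot_ang hbar) (tot_ang hbar)"

definition op_K :: spinor_op where
  "op_K = op_inner sigma1 sigma2"

definition op_A :: "real \<Rightarrow> spinor_op" where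
  "op_A hbar = op_inner (sigma1 + sigma2) (ang hbar)"

definition op_Y8 :: spinor_op where
  "op_Y8 = mult_op (\<lambda>x. 1 / norm x) \<odot> op_inner (sigma1 + sigma2) pos"

definition op_Y9 :: "real \<Rightarrow> spinor_op" where
  "op_Y9 hbar = - (mult_op (\<lambda>x. 1 / norm x) \<odot>
     (op_inner sigma1 pos \<odot> op_inner sigma2 (ang hbar) + op_inner sigma2 pos \<odot> op_inner sigma1 (ang hbar)))"

definition op_Y10 :: "real \<Rightarrow> spinor_op" where
  "op_Y10 hbar =
     mult_op (\<lambda>x. 1 / norm x) \<odot> op_inner (sigma1 + sigma2) pos \<odot> op_inner pos (mom hbar)
     - mult_op norm \<odot> op_inner (sigma1 + sigma2) (mom hbar)
     - (\<i> * of_real hbar) \<cdot> (mult_op (\<lambda>x. 1 / norm x) \<odot> op_inner (sigma1 + sigma2) pos)"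

definition hamiltonian :: "real \<Rightarrow> (real \<Rightarrow> real) \<Rightarrow> (real \<Rightarrow> real) \<Rightarrow> spinor_op" where
  "hamiltonian hbar V0 V2 =
     of_real (- hbar\<^sup>2 / 2) \<cdot> op_inner partial partial
     + mult_op (\<lambda>x. V0 (norm x))
     + mult_op (\<lambda>x. hbar / (2 * (norm x)\<^sup>2)) \<odot> op_inner (sigma1 + sigma2) (ang hbar)
     + mult_op (\<lambda>x. V2 (norm x)) \<odot> op_inner sigma1 sigma2"

definition integral_of_motion :: "spinor_op \<Rightarrow> spinor_op \<Rightarrow> bool" where
  "integral_of_motion H T \<longleftrightarrow> commutator H T \<doteq> 0"

inductive_set op_polynomials :: "spinor_op set \<Rightarrow> spinor_op set" for Z where
  const: "c \<cdot> id \<in> op_polynomials Z"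
| gen: "T \<in> Z \<Longrightarrow> T \<in> op_polynomials Z"
| add: "T \<in> op_polynomials Z \<Longrightarrow> U \<in> op_polynomials Z \<Longrightarrow> T + U \<in> op_polynomials Z"
| mult: "T \<in> op_polynomials Z \<Longrightarrow> U \<in> op_polynomials Z \<Longrightarrow> T \<odot> U \<in> op_polynomials Z"

text \<open>\<open>Gs\<close> lists the generators and \<open>Z\<close> consists of the central elements. The generators do not
  commute, so the quadratic part ranges over all ordered pairs.\<close>

definition closes_quadratically :: "spinor_op set \<Rightarrow> spinor_op list \<Rightarrow> bool" where
  "closes_quadratically Z Gs \<longleftrightarrow>
     (\<forall>T\<in>set Gs. \<forall>U\<in>set Gs. \<exists>c0 c1 c2.
        c0 \<in> op_polynomials Z \<and>
        (\<forall>i<length Gs. c1 i \<in> op_polynomials Z) \<and>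
        (\<forall>i<length Gs. \<forall>j<length Gs. c2 i j \<in> op_polynomials Z) \<and>
        commutator T U \<doteq>
          c0 + (\<Sum>i<length Gs. c1 i \<odot> Gs ! i)
             + (\<Sum>i<length Gs. \<Sum>j<length Gs. c2 i j \<odot> Gs ! i \<odot> Gs ! j))"

end

theory Submission
  imports Defs
begin

text \<open>
  With \<open>u = -\<i>\<sigma>\<^sub>1\<close>, \<open>v = -\<i>\<sigma>\<^sub>2\<close>, \<open>t = u + v\<close>, \<open>l = x \<times> \<nabla>\<close>, \<open>D = x \<cdot> \<nabla>\<close>, \<open>X = t \<cdot> x\<close>, \<open>P = t \<cdot> \<nabla>\<close>, one has
  \<open>A = \<hbar> a\<close> for \<open>a = t \<cdot> l\<close>, \<open>Y\<^sup>8 = \<i> X/r\<close> and \<open>Y\<^sup>1\<^sup>0 = \<hbar> q/r\<close> for \<open>q = X D - r\<^sup>2 P + X\<close>. All relations then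
  become identities in the ring generated by the canonical commutation relations and two
  commuting triples of quaternion units, the basic ones being \<open>[a, X] = -2 q\<close>,
  \<open>[X, P] = 2 a - t\<^sup>2\<close> and \<open>[a, q] = 2 X l\<^sup>2 - 2 q\<close>.

  Since \<open>r\<^sup>2 \<nabla>\<^sup>2 = D\<^sup>2 + D + l\<^sup>2\<close>, the Hamiltonian is a combination of functions of \<open>r\<close>, of \<open>K\<close>, and of
  \<open>r\<^sup>-\<^sup>2 (D\<^sup>2 + D + l\<^sup>2 - a)\<close>. The element \<open>l\<^sup>2 - a\<close> is \<open>J\<^sup>2\<close> up to a scalar factor and a polynomial
  in \<open>K\<close>, so it commutes with the generators, and \<open>a\<close>, \<open>X/r\<close>, \<open>q/r\<close> are of degree 0 and commute with functions of
  \<open>r\<close>; hence they commute with the Hamiltonian.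
\<close>

section \<open>Noncommutative algebra of positions, derivatives and spins\<close>

definition dot :: "(3 \<Rightarrow> 'a::ring_1) \<Rightarrow> (3 \<Rightarrow> 'a) \<Rightarrow> 'a" where
  "dot X Y = (\<Sum>k\<in>UNIV. X k * Y k)"

definition cross :: "(3 \<Rightarrow> 'a::ring_1) \<Rightarrow> (3 \<Rightarrow> 'a) \<Rightarrow> 3 \<Rightarrow> 'a" where
  "cross X Y k =
     (if k = 1 then X 2 * Y 3 - X 3 * Y 2
      else if k = 2 then X 3 * Y 1 - X 1 * Y 3
      else X 1 * Y 2 - X 2 * Y 1)"

lemma dot_3: "dot X Y = X 1 * Y 1 + X 2 * Y 2 + X 3 * Y 3"
  by (simp add: dot_def sum_3)

lemma cross_3:
  "cross X Y 1 = X 2 * Y 3 - X 3 * Y 2"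
  "cross X Y 2 = X 3 * Y 1 - X 1 * Y 3"
  "cross X Y 3 = X 1 * Y 2 - X 2 * Y 1"
  by (simp_all add: cross_def)

text \<open>Makes a reordering rule applicable inside right-associated products.\<close>

lemma mult_left_rule: "a * b = c \<Longrightarrow> a * (b * z) = c * z" for a :: "'a::ring_1"
  by (metis mult.assoc)

section \<open>Commuting elements of a ring\<close>

definition commute :: "'a::ring_1 \<Rightarrow> 'a \<Rightarrow> bool" where
  "commute a b \<longleftrightarrow> a * b = b * a"

lemma commute_sym: "commute a b \<Longrightarrow> commute b a"
  by (simp add: commute_def)

lemma commute_refl [simp]: "commute a a"
  by (simp add: commute_def)

lemma commute_add: "commute a b \<Longrightarrow> commute a c \<Longrightarrow> commute a (b + c)"
  by (simp add: commute_def algebra_simps)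

lemma commute_diff: "commute a b \<Longrightarrow> commute a c \<Longrightarrow> commute a (b - c)"
  by (simp add: commute_def algebra_simps)

lemma commute_mult: "commute a b \<Longrightarrow> commute a c \<Longrightarrow> commute a (b * c)"
  unfolding commute_def by (metis mult.assoc)

lemma commute_dot:
  assumes "\<And>k. commute a (X k)" "\<And>k. commute a (Y k)"
  shows "commute a (dot X Y)"
  unfolding dot_3 by (intro commute_add commute_mult assms)

section \<open>Canonical commutation relations and the Euler operator\<close>

locale weyl =
  fixes x d :: "3 \<Rightarrow> 'a::ring_1"
  assumes xx: "x j * x k = x k * x j"
    and dd: "d j * d k = d k * d j"
    and dx: "d j * x k = x k * d j + (if j = k then 1 else 0)"
begin

lemmas xx' = mult_left_rule[OF xx] and dd' = mult_left_rule[OF dd]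

text \<open>Normal ordering: positions to the left of derivatives, indices increasing. The
  commutativity rules are instantiated at decreasing pairs only, so that rewriting terminates; each
  rule also comes in the form for right-nested products.\<close>

lemmas weyl_nf =
  xx[of 2 1] xx[of 3 1] xx[of 3 2] xx'[of 2 1] xx'[of 3 1] xx'[of 3 2]
  dd[of 2 1] dd[of 3 1] dd[of 3 2] dd'[of 2 1] dd'[of 3 1] dd'[of 3 2]
  dx mult_left_rule[OF dx]

definition l where "l = cross x d"
definition D where "D = dot x d"

lemma l_3: "l 1 = x 2 * d 3 - x 3 * d 2" "l 2 = x 3 * d 1 - x 1 * d 3" "l 3 = x 1 * d 2 - x 2 * d 1"
  by (simp_all add: l_def cross_3)

lemma l_comm: "l 1 * l 2 = l 2 * l 1 - l 3" "l 2 * l 3 = l 3 * l 2 - l 1" "l 3 * l 1 = l 1 * l 3 - l 2"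
  by (simp_all add: l_3 weyl_nf algebra_simps)

lemma l_comm_rev: "l 2 * l 1 = l 1 * l 2 + l 3" "l 3 * l 2 = l 2 * l 3 + l 1" "l 3 * l 1 = l 1 * l 3 - l 2"
  using l_comm by (simp_all add: algebra_simps)

lemmas l_nf = l_comm_rev l_comm_rev[THEN mult_left_rule]

text \<open>Polar splitting of the Laplacian: the Euler operator \<open>D\<close> is
  \<open>r\<close> times the radial derivative, and \<open>l\<close> differentiates along
  spheres.\<close>

lemma x2_laplace: "dot x x * dot d d = D * D + D + dot l l"
  by (simp add: D_def dot_3 l_3 weyl_nf algebra_simps)

end

text \<open>Up to a factor, \<open>t\<close> is the total spin. Only its commutators are prescribed,
  since the products \<open>t j * t k\<close> do not reduce to linear expressions as those of a
  single spin one half do.\<close>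

locale spin = weyl x d for x d :: "3 \<Rightarrow> 'a::ring_1" +
  fixes t :: "3 \<Rightarrow> 'a"
  assumes tx: "t j * x k = x k * t j"
    and td: "t j * d k = d k * t j"
    and tt: "t 1 * t 2 = t 2 * t 1 + 2 * t 3" "t 2 * t 3 = t 3 * t 2 + 2 * t 1"
      "t 3 * t 1 = t 1 * t 3 + 2 * t 2"
begin

lemma tt_rev: "t 2 * t 1 = t 1 * t 2 - 2 * t 3" "t 3 * t 2 = t 2 * t 3 - 2 * t 1" "t 3 * t 1 = t 1 * t 3 + 2 * t 2"
  using tt by (simp_all add: algebra_simps)

lemmas spin_nf = tx mult_left_rule[OF tx] td mult_left_rule[OF td] tt_rev tt_rev[THEN mult_left_rule]

definition X where "X = dot t x"
definition P where "P = dot t d"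
definition a where "a = dot t l"

lemma a_X: "a * X = X * a - 2 * (X * (D + 1) - dot x x * P)"
  by (simp add: X_def P_def a_def D_def dot_3 l_3 weyl_nf spin_nf algebra_simps mult_2 mult_2_right)

text \<open>The counterpart of \<open>a_X\<close> under the automorphism taking \<open>x\<close> to
  \<open>d\<close> and \<open>d\<close> to \<open>- x\<close>: it fixes \<open>t\<close>,
  \<open>l\<close> and \<open>a\<close>, takes \<open>X\<close> to \<open>P\<close>,
  \<open>P\<close> to \<open>- X\<close> and \<open>D\<close> to \<open>- (D + 3)\<close>.\<close>

lemma a_P: "a * P = P * a + 2 * (P * (D + 2) - dot d d * X)"
  by (simp add: X_def P_def a_def D_def dot_3 l_3 weyl_nf spin_nf algebra_simps mult_2 mult_2_right)

text \<open>The commutators of the components of \<open>t\<close> assemble to \<open>2 * a\<close>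
  through the cross product of \<open>x\<close> and \<open>d\<close>; moving derivatives past
  positions leaves \<open>- dot t t\<close>.\<close>

lemma X_P: "X * P = P * X + 2 * a - dot t t"
  by (simp add: X_def P_def a_def D_def dot_3 l_3 weyl_nf spin_nf algebra_simps mult_2 mult_2_right)

lemma D_X: "D * X = X * D + X"
  by (simp add: X_def D_def dot_3 weyl_nf spin_nf algebra_simps)

lemma D_P: "D * P = P * D - P"
  by (simp add: P_def D_def dot_3 weyl_nf spin_nf algebra_simps)

lemma D_xx: "D * dot x x = dot x x * D + 2 * dot x x"
  by (simp add: D_def dot_3 weyl_nf algebra_simps mult_2 mult_2_right)

lemma xx_X: "dot x x * X = X * dot x x"
  by (simp add: X_def dot_3 weyl_nf spin_nf algebra_simps)

lemma laplace_X: "dot d d * X = X * dot d d + 2 * P"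
  by (simp add: P_def X_def dot_3 weyl_nf spin_nf algebra_simps mult_2 mult_2_right)

lemma a_D: "a * D = D * a"
  by (simp add: a_def D_def dot_3 l_3 weyl_nf spin_nf algebra_simps)

lemma a_xx: "a * dot x x = dot x x * a"
  by (simp add: a_def dot_3 l_3 weyl_nf spin_nf algebra_simps)

definition c where "c = dot l l - a"

lemma c_D: "c * D = D * c"
  by (simp add: c_def a_D algebra_simps) (simp add: D_def dot_3 l_3 weyl_nf algebra_simps)

lemma c_xx: "c * dot x x = dot x x * c"
  by (simp add: c_def a_xx algebra_simps) (simp add: dot_3 l_3 weyl_nf algebra_simps)

text \<open>A full expansion is avoided: \<open>dot l l\<close> is the Casimir element of the triple
  \<open>l\<close>, so it commutes with each \<open>l k\<close>, and also with each
  \<open>t k\<close>, hence with \<open>a\<close>.\<close>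

lemma c_a: "c * a = a * c"
proof -
  have *: "dot l l * l k = l k * dot l l" for k
    using exhaust_3[of k] by (auto simp: dot_3 l_nf algebra_simps)
  have "t j * l k = l k * t j" for j k
    using exhaust_3[of k] by (auto simp: l_3 spin_nf algebra_simps)
  then have "dot l l * t k = t k * dot l l" for k
    by (simp add: dot_def sum_distrib_left sum_distrib_right) (simp add: mult.assoc mult_left_rule[of "t _"])
  with * have "commute (dot l l) a"
    unfolding a_def by (intro commute_dot) (simp_all add: commute_def)
  then show ?thesis
    by (simp add: c_def commute_def algebra_simps)
qed

text \<open>\<open>X\<close> is a scalar under the joint rotations generated by
  \<open>l - t/2\<close>, whose square is \<open>c\<close> plus a quarter of the Casimir element
  \<open>dot t t\<close>. The same reason applies to \<open>P\<close>.\<close>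

lemma c_X: "c * X = X * c"
  by (simp add: c_def X_def a_def dot_3 l_3 weyl_nf spin_nf algebra_simps mult_2 mult_2_right)

lemma c_P: "c * P = P * c"
  by (simp add: c_def P_def a_def dot_3 l_3 weyl_nf spin_nf algebra_simps mult_2 mult_2_right)

text \<open>By \<open>a_X\<close> the commutator of \<open>X\<close> and \<open>a\<close> is
  \<open>2 * q\<close>; the explicit form avoids a division by 2 in the ring.\<close>

definition q where "q = X * D - dot x x * P + X"

lemma a_q: "a * q - q * a = 2 * (X * dot l l) - 2 * q"
proof -
  \<comment> \<open>Taking the commutator with \<open>a\<close> is a derivation that vanishes on
    \<open>D\<close> and on \<open>dot x x\<close>.\<close>
  have "a * q - q * a = (a * X - X * a) * (D + 1) - dot x x * (a * P - P * a)"
    by (simp add: q_def algebra_simps a_D a_xx mult_left_rule[OF a_xx] mult_left_rule[OF a_D])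
  also have "\<dots> = - 2 * (X * (D + 1) - dot x x * P) * (D + 1)
      - 2 * (dot x x * P * (D + 2)) + 2 * (dot x x * (dot d d * X))"
    by (simp add: a_X a_P algebra_simps mult_2 mult_2_right)
  \<comment> \<open>With \<open>X\<close> moved to the left, \<open>x2_laplace\<close> applies; the
    terms of second order in \<open>D\<close> then cancel, and \<open>dot l l\<close>
    survives.\<close>
  also have "dot x x * (dot d d * X) = X * (dot x x * dot d d) + 2 * (dot x x * P)"
    by (simp add: laplace_X algebra_simps mult_2 xx_X mult_left_rule[OF xx_X])
  finally show ?thesis
    by (simp add: x2_laplace q_def algebra_simps mult_2 mult_2_right)
qed

lemma X_q: "X * q - q * X = dot x x * (dot t t - 2 * a) - X * X"
proof -
  have "X * q - q * X = X * (X * D - D * X) - dot x x * (X * P - P * X)"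
    by (simp add: q_def algebra_simps xx_X mult_left_rule[OF xx_X])
  then show ?thesis
    by (simp add: X_P D_X algebra_simps)
qed

text \<open>\<open>q\<close> is homogeneous of degree one, like \<open>X\<close>, because each
  position raises the degree by one and each derivative lowers it by one.\<close>

lemma D_q: "D * q = q * D + q"
  by (simp add: q_def algebra_simps D_X D_P D_xx mult_left_rule[OF D_X] mult_left_rule[OF D_P]
      mult_left_rule[OF D_xx] mult_2)

lemma c_q: "c * q = q * c"
  by (simp add: q_def algebra_simps c_X c_P c_D c_xx mult_left_rule[OF c_X] mult_left_rule[OF c_P]
      mult_left_rule[OF c_D] mult_left_rule[OF c_xx])

text \<open>An abstract function of \<open>r\<close>: its gradient is parallel to the position vector.\<close>

definition radial :: "'a \<Rightarrow> bool" where
  "radial f \<longleftrightarrow> (\<forall>k. commute f (x k)) \<and> (\<forall>k. commute f (t k)) \<and>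
     (\<exists>g. \<forall>k. d k * f = f * d k + x k * g)"

context
  fixes f assumes f: "radial f"
begin

lemma radial_x: "f * x k = x k * f" and radial_t: "f * t k = t k * f"
  using f by (auto simp: radial_def commute_def)

lemma radial_X: "f * X = X * f"
  using commute_dot[of f t x] f by (simp add: X_def radial_def commute_def)

lemma radial_xx: "f * dot x x = dot x x * f"
  using commute_dot[of f x x] f by (simp add: radial_def commute_def)

text \<open>The gradient of \<open>f\<close> contributes the cross product of \<open>x\<close> with
  itself, multiplied by \<open>g\<close> on the right, which is zero.\<close>

lemma radial_l: "f * l k = l k * f"
proof -
  obtain g where "\<And>k. d k * f = f * d k + x k * g"
    using f by (auto simp: radial_def)
  then show ?thesis
    using exhaust_3[of k]
    by (auto simp: l_3 algebra_simps radial_x mult_left_rule[OF radial_x] weyl_nf)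
qed

lemma radial_a: "f * a = a * f"
  using commute_dot[of f t l] radial_l radial_t by (simp add: a_def commute_def)

lemma radial_c: "f * c = c * f"
  using commute_dot[of f l l] radial_l radial_a by (simp add: c_def commute_def algebra_simps)

text \<open>The gradient enters through \<open>X * D\<close> as \<open>X * (dot x x * g)\<close> and
  through \<open>dot x x * P\<close> as \<open>dot x x * (X * g)\<close>; the two cancel in
  \<open>q\<close>.\<close>

lemma radial_q: "f * q = q * f"
proof -
  obtain g where g: "\<And>k. d k * f = f * d k + x k * g"
    using f by (auto simp: radial_def)
  have D: "D * f = f * D + dot x x * g"
    by (simp add: D_def dot_3 algebra_simps g radial_x mult_left_rule[OF radial_x])
  have P: "P * f = f * P + X * g"
    by (simp add: P_def X_def dot_3 algebra_simps g radial_t mult_left_rule[OF radial_t])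
  show ?thesis
    by (simp add: q_def algebra_simps D P xx_X mult_left_rule[OF xx_X] radial_X mult_left_rule[OF radial_X]
        radial_xx mult_left_rule[OF radial_xx])
qed

end

end

section \<open>Two commuting spins and the inverse radius\<close>

definition quaternion_units :: "(3 \<Rightarrow> 'a::ring_1) \<Rightarrow> bool" where
  "quaternion_units u \<longleftrightarrow> (\<forall>k. u k * u k = - 1) \<and>
     u 1 * u 2 = u 3 \<and> u 2 * u 3 = u 1 \<and> u 3 * u 1 = u 2 \<and>
     u 2 * u 1 = - u 3 \<and> u 3 * u 2 = - u 1 \<and> u 1 * u 3 = - u 2"

lemma quaternion_unitsD:
  assumes "quaternion_units u"
  shows "u k * u k = - 1" "u 1 * u 2 = u 3" "u 2 * u 3 = u 1" "u 3 * u 1 = u 2"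
    "u 2 * u 1 = - u 3" "u 3 * u 2 = - u 1" "u 1 * u 3 = - u 2"
  using assms by (auto simp: quaternion_units_def)

text \<open>\<open>\<rho>\<close> plays the role of \<open>1/r\<close>.\<close>

locale spin_pair = weyl x d for x d :: "3 \<Rightarrow> 'a::ring_1" +
  fixes u v :: "3 \<Rightarrow> 'a" and \<rho> :: 'a
  assumes ux: "u j * x k = x k * u j" and ud: "u j * d k = d k * u j"
    and vx: "v j * x k = x k * v j" and vd: "v j * d k = d k * v j"
    and vu: "v j * u k = u k * v j"
    and u: "quaternion_units u" and v: "quaternion_units v"
    and \<rho>x: "\<rho> * x k = x k * \<rho>" and \<rho>u: "\<rho> * u k = u k * \<rho>" and \<rho>v: "\<rho> * v k = v k * \<rho>"
    and d\<rho>: "d k * \<rho> = \<rho> * d k - x k * (\<rho> * \<rho> * \<rho>)"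
    and xx\<rho>\<rho>: "dot x x * (\<rho> * \<rho>) = 1"
begin

lemmas pair_nf = ux mult_left_rule[OF ux] ud mult_left_rule[OF ud]
  vx mult_left_rule[OF vx] vd mult_left_rule[OF vd] vu mult_left_rule[OF vu]
  quaternion_unitsD[OF u] quaternion_unitsD[OF u, THEN mult_left_rule]
  quaternion_unitsD[OF v] quaternion_unitsD[OF v, THEN mult_left_rule]

sublocale spin x d "\<lambda>k. u k + v k"
  by unfold_locales (simp_all add: pair_nf algebra_simps mult_2)

abbreviation t where "t \<equiv> \<lambda>k. u k + v k"

definition \<kappa> where "\<kappa> = dot u v"
definition y where "y = \<rho> * X"
definition Q where "Q = \<rho> * q"

lemma tt_eq: "dot t t = 2 * \<kappa> - 6"
proof -
  \<comment> \<open>The six squares of units stay an explicit sum of \<open>- 1\<close> until the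
    last simplification collects them.\<close>
  have "dot t t = 2 * \<kappa> + (- 1 + - 1 + - 1 + - 1 + - 1 + - 1)"
    by (simp add: \<kappa>_def dot_3 pair_nf algebra_simps mult_2)
  then show ?thesis by simp
qed

text \<open>By \<open>tt_eq\<close>, \<open>2 * \<kappa>\<close> is the Casimir element
  \<open>dot t t\<close> up to a constant; the products of quaternion units confirm the commutation
  directly.\<close>

lemma \<kappa>_t: "\<kappa> * t k = t k * \<kappa>"
  using exhaust_3[of k] by (auto simp: \<kappa>_def dot_3 pair_nf algebra_simps)

lemma \<kappa>_x: "\<kappa> * x k = x k * \<kappa>" and \<kappa>_d: "\<kappa> * d k = d k * \<kappa>"
  by (simp_all add: \<kappa>_def dot_3 pair_nf algebra_simps)

lemma radial_\<rho>: "radial \<rho>"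
  unfolding radial_def commute_def
proof (intro conjI allI exI)
  show "d k * \<rho> = \<rho> * d k + x k * (- (\<rho> * \<rho> * \<rho>))" for k
    by (simp add: d\<rho>)
qed (simp_all add: \<rho>x \<rho>u \<rho>v algebra_simps)

lemma commute_cross: "(\<And>k. commute b (Y k)) \<Longrightarrow> (\<And>k. commute b (Z k)) \<Longrightarrow> commute b (cross Y Z k)"
  by (simp add: cross_def commute_diff commute_mult)

lemma commute_\<rho>: "commute \<rho> a" "commute \<rho> c" "commute \<rho> y" "commute \<rho> Q" "commute \<rho> X" "commute \<rho> q"
proof -
  show *: "commute \<rho> a" "commute \<rho> c" "commute \<rho> X" "commute \<rho> q"
    using radial_\<rho> by (simp_all add: commute_def radial_a radial_c radial_X radial_q)
  show "commute \<rho> y" "commute \<rho> Q"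
    by (simp_all add: y_def Q_def commute_mult *)
qed

lemma commute_c: "commute c a" "commute c y" "commute c Q"
  using commute_\<rho>(2) by (auto simp: y_def Q_def commute_def[of c X] commute_def[of c q] commute_def[of c a]
      c_a c_X c_q intro!: commute_mult dest: commute_sym)

lemma commute_l: "(\<And>k. commute b (x k)) \<Longrightarrow> (\<And>k. commute b (d k)) \<Longrightarrow> commute b (l k)"
  unfolding l_def by (rule commute_cross)

lemma commute_\<kappa>_\<rho>: "commute \<kappa> \<rho>"
  using commute_dot[of \<rho> u v] by (simp add: commute_def \<kappa>_def \<rho>u \<rho>v)

lemma commute_\<kappa>: "commute \<kappa> a" "commute \<kappa> c" "commute \<kappa> y" "commute \<kappa> Q" "commute \<kappa> D"
proof -
  have xdt: "commute \<kappa> (x k)" "commute \<kappa> (d k)" "commute \<kappa> (t k)" for k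
    using \<kappa>_x \<kappa>_d \<kappa>_t[of k] by (auto simp: commute_def)
  note commute_\<kappa>_\<rho>
  moreover have l: "commute \<kappa> (l k)" for k
    by (intro commute_l xdt)
  ultimately show "commute \<kappa> a" "commute \<kappa> c" "commute \<kappa> y" "commute \<kappa> Q" "commute \<kappa> D"
    unfolding c_def y_def Q_def q_def a_def X_def P_def D_def
    by (intro commute_mult commute_add commute_diff commute_dot xdt; simp)+
qed

text \<open>\<open>\<rho>\<close> has degree -1 under the Euler operator, which makes
  \<open>y\<close> and \<open>Q\<close> of degree 0 and hence commute with \<open>D\<close>.\<close>

lemma D_\<rho>: "D * \<rho> = \<rho> * D - \<rho>"
proof -
  have "D * \<rho> = \<rho> * D - dot x x * (\<rho> * \<rho>) * \<rho>"
    by (simp add: D_def dot_3 d\<rho> algebra_simps \<rho>x mult_left_rule[OF \<rho>x])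
  then show ?thesis by (simp add: xx\<rho>\<rho>)
qed

lemma commute_D: "commute D a" "commute D y" "commute D Q" "commute D \<kappa>"
  using commute_sym[OF commute_\<kappa>(5)]
  by (simp_all add: commute_def a_D y_def Q_def mult_left_rule[OF D_\<rho>] D_X D_q algebra_simps)

lemma a_\<rho>: "a * \<rho> = \<rho> * a"
  using commute_\<rho>(1) by (simp add: commute_def)

lemma a_y: "a * y - y * a = - 2 * Q"
proof -
  have "a * y - y * a = \<rho> * (a * X - X * a)"
    by (simp add: y_def algebra_simps mult_left_rule[OF a_\<rho>])
  then show ?thesis
    by (simp add: a_X Q_def q_def algebra_simps mult_2 mult_2_right)
qed

lemma \<rho>_xx: "\<rho> * (\<rho> * (dot x x * z)) = z"
proof -
  have "\<rho> * (\<rho> * dot x x) = dot x x * (\<rho> * \<rho>)"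
    using radial_xx[OF radial_\<rho>] by (metis mult.assoc)
  then show ?thesis
    by (metis xx\<rho>\<rho> mult.assoc mult_1_left)
qed

text \<open>This is \<open>X_q\<close> divided by the square of the radius: \<open>\<rho>\<close>
  commutes with \<open>X\<close> and \<open>q\<close>, and its square cancels
  \<open>dot x x\<close>.\<close>

lemma y_Q: "y * Q - Q * y = 2 * \<kappa> - 6 - 2 * a - y * y"
proof -
  have *: "X * \<rho> = \<rho> * X" "q * \<rho> = \<rho> * q"
    using commute_\<rho>(5,6) by (simp_all add: commute_def)
  have "y * Q - Q * y = \<rho> * (\<rho> * (X * q - q * X))"
    by (simp add: y_def Q_def algebra_simps * mult_left_rule[OF *(1)] mult_left_rule[OF *(2)])
  also have "\<dots> = dot t t - 2 * a - \<rho> * (\<rho> * (X * X))"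
    by (simp only: X_q right_diff_distrib[of \<rho>] \<rho>_xx)
  also have "\<rho> * (\<rho> * (X * X)) = y * y"
    by (simp add: y_def algebra_simps * mult_left_rule[OF *(1)])
  finally show ?thesis by (simp add: tt_eq)
qed

lemma a_Q: "a * Q - Q * a = 2 * (y * dot l l) - 2 * Q"
proof -
  have "a * Q - Q * a = \<rho> * (a * q - q * a)"
    by (simp add: Q_def algebra_simps mult_left_rule[OF a_\<rho>])
  then show ?thesis
    by (simp add: a_q y_def Q_def algebra_simps mult_2)
qed

text \<open>The source of the dependence of the ninth operator on the others. In
  \<open>X * a\<close> the terms with two different spins form the left side. The terms with equal
  spins reduce, since \<open>dot x l\<close> vanishes, to \<open>t\<close> contracted with the cross
  product of \<open>x\<close> and \<open>l\<close>, which is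
  \<open>X * D - dot x x * P = q - X\<close>.\<close>

lemma \<rho>_mixed: "\<rho> * (dot u x * dot v l + dot v x * dot u l) = y * a - Q + y"
proof -
  have "dot u x * dot v l + dot v x * dot u l = X * a - q + X"
    by (simp add: X_def a_def q_def D_def P_def dot_3 l_3 weyl_nf pair_nf algebra_simps)
  then have "\<rho> * (dot u x * dot v l + dot v x * dot u l) = \<rho> * (X * a - q + X)"
    by (rule arg_cong)
  then show ?thesis
    by (simp only: y_def Q_def distrib_left right_diff_distrib mult.assoc)
qed

lemma laplace: "dot d d = \<rho> * \<rho> * (D * D + D + dot l l)"
  using \<rho>_xx[of "dot d d"] by (simp add: x2_laplace mult.assoc)

text \<open>The total angular momentum with its factor \<open>- \<i> * hbar / 2\<close> removed.
  Since \<open>l\<close> and \<open>t\<close> commute, the mixed terms combine to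
  \<open>- 4 * a\<close>, and the constant is the squared total spin \<open>dot t t\<close>.\<close>

lemma b_b: "dot (\<lambda>k. 2 * l k - t k) (\<lambda>k. 2 * l k - t k) = 4 * dot l l - 4 * a + (2 * \<kappa> - 6)"
proof -
  have four: "4 * z = 2 * z + 2 * z" for z :: 'a
    by (simp flip: distrib_right)
  have "l j * t k = t k * l j" for j k
    by (rule commute_l[of "t k" j, unfolded commute_def, symmetric]) (simp_all add: pair_nf algebra_simps)
  then have "dot (\<lambda>k. 2 * l k - t k) (\<lambda>k. 2 * l k - t k) = 4 * dot l l - 4 * a + dot t t"
    by (simp add: a_def dot_3 four mult_2 mult_2_right algebra_simps)
  then show ?thesis by (simp add: tt_eq)
qed

text \<open>By \<open>laplace\<close>, this is \<open>dot d d\<close> minus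
  \<open>\<rho> * \<rho> * a\<close>: the spin-orbit term replaces \<open>dot l l\<close> by
  \<open>c\<close>, and each of \<open>\<rho>\<close>, \<open>D\<close> and \<open>c\<close>
  commutes with \<open>z\<close>.\<close>

lemma commute_energy:
  assumes "z \<in> {\<kappa>, a, y, Q}"
  shows "commute (\<rho> * \<rho> * (D * D + D + c)) z"
proof -
  have "commute z \<rho>" "commute z D" "commute z c"
    using assms commute_\<rho> commute_D commute_c commute_\<kappa> commute_\<kappa>_\<rho> by (auto simp: commute_def)
  then show ?thesis
    by (intro commute_sym[of z] commute_mult commute_add)
qed

end

section \<open>Smooth functions\<close>

lemma Ck_on_cong:
  assumes "open S" "\<And>x. x \<in> S \<Longrightarrow> f x = g x" "Ck_on n S f"
  shows "Ck_on n S g"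
  using assms(2,3)
proof (induction n arbitrary: f g)
  case 0
  then show ?case by (simp cong: continuous_on_cong)
next
  case (Suc n)
  have "g differentiable (at x)" if "x \<in> S" for x
    using Suc.prems that assms(1)
    by (metis Ck_on.simps(2) differentiable_def has_derivative_transform_within_open)
  moreover have "Ck_on n S (\<lambda>x. frechet_derivative g (at x) v)" for v
  proof (rule Suc.IH)
    show "Ck_on n S (\<lambda>x. frechet_derivative f (at x) v)"
      using Suc.prems by simp
    show "frechet_derivative f (at x) v = frechet_derivative g (at x) v" if "x \<in> S" for x
      using Suc.prems that assms(1)
      by (metis Ck_on.simps(2) frechet_derivative_transform_within_open)
  qed
  ultimately show ?case by simp
qed

text \<open>Lets an explicit derivative stand for \<open>frechet_derivative\<close>, with which it
  agrees on \<open>S\<close> by uniqueness.\<close>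

lemma Ck_on_SucI:
  assumes "open S" "\<And>x. x \<in> S \<Longrightarrow> (f has_derivative f' x) (at x)"
    "\<And>v. Ck_on n S (\<lambda>x. f' x v)"
  shows "Ck_on (Suc n) S f"
proof -
  have "Ck_on n S (\<lambda>x. frechet_derivative f (at x) v)" for v
    by (rule Ck_on_cong[OF assms(1) _ assms(3)[of v]]) (simp add: frechet_derivative_at[OF assms(2)])
  then show ?thesis
    using assms(2) by (auto simp: differentiable_def)
qed

lemma Ck_on_Suc_has_derivative:
  "Ck_on (Suc n) S f \<Longrightarrow> x \<in> S \<Longrightarrow> (f has_derivative frechet_derivative f (at x)) (at x)"
  using frechet_derivative_works by auto

lemma Ck_on_SucD: "Ck_on (Suc n) S f \<Longrightarrow> Ck_on n S f"
proof (induction n arbitrary: f)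
  case 0
  then show ?case
    by (simp add: differentiable_imp_continuous_on differentiable_at_imp_differentiable_on)
next
  case (Suc n)
  then show ?case by (metis Ck_on.simps(2))
qed

lemma Ck_on_const: "open S \<Longrightarrow> Ck_on n S (\<lambda>x. c)"
proof (induction n arbitrary: c)
  case (Suc n)
  show ?case
    by (rule Ck_on_SucI[OF Suc.prems has_derivative_const Suc.IH[OF Suc.prems]])
qed simp

lemma Ck_on_bounded_linear:
  assumes "open S" "bounded_linear h" "Ck_on n S f"
  shows "Ck_on n S (\<lambda>x. h (f x))"
  using assms(3)
proof (induction n arbitrary: f)
  case 0
  then show ?case
    by (simp add: bounded_linear.continuous_on[OF assms(2)])
next
  case (Suc n)
  show ?case
    by (rule Ck_on_SucI[OF assms(1) bounded_linear.has_derivative[OF assms(2) Ck_on_Suc_has_derivative[OF Suc.prems]]])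
      (use Suc in auto)
qed

lemma Ck_on_add:
  assumes "open S" "Ck_on n S f" "Ck_on n S g"
  shows "Ck_on n S (\<lambda>x. f x + g x)"
  using assms(2,3)
proof (induction n arbitrary: f g)
  case 0
  then show ?case by (simp add: continuous_on_add)
next
  case (Suc n)
  show ?case
    by (rule Ck_on_SucI[OF assms(1) has_derivative_add[OF Suc.prems[THEN Ck_on_Suc_has_derivative]]])
      (use Suc in auto)
qed

text \<open>Leibniz rule: each summand pairs one derivative with one undifferentiated factor, which
  \<open>Ck_on_SucD\<close> lowers to order \<open>n\<close> for the induction hypothesis.\<close>

lemma Ck_on_bounded_bilinear:
  assumes "open S" "bounded_bilinear b" "Ck_on n S f" "Ck_on n S g"
  shows "Ck_on n S (\<lambda>x. b (f x) (g x))"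
  using assms(3,4)
proof (induction n arbitrary: f g)
  case 0
  then show ?case by (simp add: bounded_bilinear.continuous_on[OF assms(2)])
next
  case (Suc n)
  show ?case
  proof (rule Ck_on_SucI[OF assms(1) bounded_bilinear.FDERIV[OF assms(2) Suc.prems[THEN Ck_on_Suc_has_derivative]]])
    show "Ck_on n S (\<lambda>x. b (f x) (frechet_derivative g (at x) v) + b (frechet_derivative f (at x) v) (g x))" for v
      using Suc.prems by (intro Ck_on_add assms Suc.IH) (auto intro: Ck_on_SucD simp del: Ck_on.simps(1))
  qed
qed

lemma Ck_on_id: "open S \<Longrightarrow> Ck_on n S (\<lambda>x. x)"
  by (cases n) (auto intro!: Ck_on_SucI has_derivative_ident Ck_on_const simp del: Ck_on.simps(2))

lemma smooth_on_cong:
  "open S \<Longrightarrow> (\<And>x. x \<in> S \<Longrightarrow> f x = g x) \<Longrightarrow> smooth_on S f \<Longrightarrow> smooth_on S g"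
  unfolding smooth_on_def by (blast intro: Ck_on_cong)

lemma smooth_on_const: "open S \<Longrightarrow> smooth_on S (\<lambda>x. c)"
  by (simp add: smooth_on_def Ck_on_const)

lemma smooth_on_id: "open S \<Longrightarrow> smooth_on S (\<lambda>x. x)"
  by (simp add: smooth_on_def Ck_on_id)

lemma smooth_on_bounded_linear:
  "open S \<Longrightarrow> bounded_linear h \<Longrightarrow> smooth_on S f \<Longrightarrow> smooth_on S (\<lambda>x. h (f x))"
  by (simp add: smooth_on_def Ck_on_bounded_linear)

lemma smooth_on_add:
  "open S \<Longrightarrow> smooth_on S f \<Longrightarrow> smooth_on S g \<Longrightarrow> smooth_on S (\<lambda>x. f x + g x)"
  by (simp add: smooth_on_def Ck_on_add)

lemma smooth_on_bounded_bilinear: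
  "open S \<Longrightarrow> bounded_bilinear b \<Longrightarrow> smooth_on S f \<Longrightarrow> smooth_on S g \<Longrightarrow> smooth_on S (\<lambda>x. b (f x) (g x))"
  by (simp add: smooth_on_def Ck_on_bounded_bilinear)

lemmas smooth_on_scaleR = smooth_on_bounded_bilinear[OF _ bounded_bilinear_scaleR]
lemmas smooth_on_mult = smooth_on_bounded_bilinear[OF _ bounded_bilinear_mult]

lemma smooth_on_directional_derivative:
  "smooth_on S f \<Longrightarrow> smooth_on S (\<lambda>x. frechet_derivative f (at x) v)"
  unfolding smooth_on_def by (metis Ck_on.simps(2))

lemma smooth_on_has_derivative:
  "smooth_on S f \<Longrightarrow> x \<in> S \<Longrightarrow> (f has_derivative frechet_derivative f (at x)) (at x)"
  unfolding smooth_on_def by (blast intro: Ck_on_Suc_has_derivative)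

lemma open_punctured: "open (- {0 :: 'a::euclidean_space})"
  by (simp add: open_Compl)

text \<open>The derivative is a polynomial in the function itself and the linear form
  \<open>x \<bullet> v\<close>, so the induction closes.\<close>

lemma Ck_on_inverse_norm: "Ck_on n (- {0}) (\<lambda>x::'a::euclidean_space. inverse (norm x))"
proof (induction n)
  case 0
  show ?case by (auto intro!: continuous_intros)
next
  case (Suc n)
  show ?case
  proof (rule Ck_on_SucI[OF open_punctured])
    show "((\<lambda>x. inverse (norm x)) has_derivative
        (\<lambda>v. - (inverse (norm x) * inverse (norm x) * inverse (norm x) * (x \<bullet> v)))) (at x)"
      if "x \<in> - {0}" for x :: 'a
      by (rule has_derivative_eq_rhs[OF Deriv.has_derivative_inverse[OF _ has_derivative_norm]])
        (use that in \<open>auto simp: sgn_div_norm inner_commute\<close>)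
    show "Ck_on n (- {0}) (\<lambda>x::'a. - (inverse (norm x) * inverse (norm x) * inverse (norm x) * (x \<bullet> v)))" for v
      by (intro Ck_on_bounded_linear[OF open_punctured bounded_linear_minus[OF bounded_linear_ident]]
          Ck_on_bounded_bilinear[OF open_punctured bounded_bilinear_mult] Suc
          Ck_on_bounded_linear[OF open_punctured bounded_linear_inner_left] Ck_on_id open_punctured)
  qed
qed

lemma has_derivative_comp_norm:
  fixes x :: "'a::euclidean_space"
  assumes "(V has_derivative V') (at (norm x))" "x \<noteq> 0"
  shows "((\<lambda>x. V (norm x)) has_derivative (\<lambda>v. V' 1 * ((x \<bullet> v) * inverse (norm x)))) (at x)"
proof -
  have "(V has_derivative (\<lambda>h. V' 1 * h)) (at (norm x))"
    using assms(1) by (metis has_derivative_bounded_linear bounded_linear.linear linear_cmul mult.right_neutral real_scaleR_def mult.commute ext)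
  then have "((\<lambda>x. V (norm x)) has_derivative (\<lambda>v. V' 1 * (v \<bullet> sgn x))) (at x)"
    by (rule has_derivative_compose[OF has_derivative_norm[OF assms(2)]])
  then show ?thesis
    by (simp add: sgn_div_norm inner_commute field_simps)
qed

text \<open>The profile \<open>V\<close> varies in the induction: the chain rule replaces it by its
  derivative and adds factors already known to be regular.\<close>

lemma Ck_on_comp_norm:
  "Ck_on n {0<..} V \<Longrightarrow> Ck_on n (- {0}) (\<lambda>x::'a::euclidean_space. V (norm x) :: real)"
proof (induction n arbitrary: V)
  case 0
  then show ?case by (auto intro!: continuous_on_compose2[of "{0<..}" V] continuous_intros)
next
  case (Suc n)
  show ?case
  proof (rule Ck_on_SucI[OF open_punctured])
    show "((\<lambda>x. V (norm x)) has_derivative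
        (\<lambda>v. frechet_derivative V (at (norm x)) 1 * ((x \<bullet> v) * inverse (norm x)))) (at x)"
      if "x \<in> - {0}" for x :: 'a
      using that Ck_on_Suc_has_derivative[OF Suc.prems] by (intro has_derivative_comp_norm) auto
    show "Ck_on n (- {0}) (\<lambda>x::'a. frechet_derivative V (at (norm x)) 1 * ((x \<bullet> v) * inverse (norm x)))" for v
      using Suc.prems
      by (intro Ck_on_bounded_bilinear[OF open_punctured bounded_bilinear_mult] Suc.IH[of "\<lambda>r. frechet_derivative V (at r) 1"]
          Ck_on_inverse_norm Ck_on_bounded_linear[OF open_punctured bounded_linear_inner_left] Ck_on_id open_punctured) simp
  qed
qed

lemma smooth_on_comp_norm:
  "smooth_on {0<..} V \<Longrightarrow> smooth_on (- {0}) (\<lambda>x::'a::euclidean_space. V (norm x) :: real)"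
  by (simp add: smooth_on_def Ck_on_comp_norm)

section \<open>Symmetry of second derivatives\<close>

lemma second_difference:
  fixes f :: "'a::euclidean_space \<Rightarrow> real"
  assumes "Ck_on (Suc (Suc n)) S f" "ball x e \<subseteq> S" "0 < h" "h * (norm v + norm w) < e"
  obtains p where "dist x p \<le> h * (norm v + norm w)"
    "f (x + h *\<^sub>R v + h *\<^sub>R w) - f (x + h *\<^sub>R v) - f (x + h *\<^sub>R w) + f x =
      h * h * frechet_derivative (\<lambda>y. frechet_derivative f (at y) v) (at p) w"
proof -
  let ?p = "\<lambda>s t. x + s *\<^sub>R v + t *\<^sub>R w"
  let ?Dv = "\<lambda>y. frechet_derivative f (at y) v"
  have d: "dist x (?p s t) \<le> h * (norm v + norm w)" if "0 \<le> s" "s \<le> h" "0 \<le> t" "t \<le> h" for s t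
  proof -
    have "dist x (?p s t) = norm (s *\<^sub>R v + t *\<^sub>R w)"
      by (metis dist_norm norm_minus_commute add_diff_cancel_left' add.assoc)
    also have "\<dots> \<le> s * norm v + t * norm w"
      using norm_triangle_ineq[of "s *\<^sub>R v" "t *\<^sub>R w"] that by simp
    also have "\<dots> \<le> h * norm v + h * norm w"
      using that by (intro add_mono mult_right_mono) auto
    finally show ?thesis by (simp add: algebra_simps)
  qed
  then have S: "?p s t \<in> S" if "0 \<le> s" "s \<le> h" "0 \<le> t" "t \<le> h" for s t
    using that assms(2,4) by (meson mem_ball order_le_less_trans subsetD)
  have f: "(f has_derivative frechet_derivative f (at (?p s t))) (at (?p s t))"
    and Df: "(?Dv has_derivative frechet_derivative ?Dv (at (?p s t))) (at (?p s t))"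
    if "0 \<le> s" "s \<le> h" "0 \<le> t" "t \<le> h" for s t
    using Ck_on_Suc_has_derivative[OF assms(1) S[OF that]] Ck_on_Suc_has_derivative[OF _ S[OF that], of n ?Dv] assms(1)
    by simp_all
  \<comment> \<open>The shift \<open>y'\<close> makes one rule serve both parameters: it is
    \<open>h\<close> or 0 times \<open>w\<close> while \<open>s\<close> varies, and 0 while
    \<open>t\<close> varies.\<close>
  have line: "((\<lambda>s. g (y + s *\<^sub>R z + y')) has_derivative
      (\<lambda>c. c * frechet_derivative g (at (y + s *\<^sub>R z + y')) z)) (at s)"
    if g: "(g has_derivative frechet_derivative g (at (y + s *\<^sub>R z + y'))) (at (y + s *\<^sub>R z + y'))"
    for g :: "'a \<Rightarrow> real" and y y' z s
  proof -
    have "((\<lambda>s. y + s *\<^sub>R z + y') has_derivative (\<lambda>c. c *\<^sub>R z)) (at s)"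
      by (auto intro!: derivative_eq_intros)
    from has_derivative_compose[OF this g] show ?thesis
      by (simp add: linear_cmul[OF has_derivative_linear[OF g]])
  qed
  \<comment> \<open>The mean value theorem is applied to the difference along two opposite edges of
    the parallelogram, and then across it at the intermediate \<open>s\<close>; each application
    yields a factor \<open>h\<close>.\<close>
  have "((\<lambda>s. f (?p s h) - f (?p s 0)) has_derivative
      (\<lambda>c. c * ?Dv (?p s h) - c * ?Dv (?p s 0))) (at s)"
    if "0 \<le> s" "s \<le> h" for s
    using that assms(3) by (intro has_derivative_diff line f) auto
  from mvt_simple[OF assms(3) has_derivative_at_withinI[OF this]]
  obtain s where s: "0 < s" "s < h" and
    1: "(f (?p h h) - f (?p h 0)) - (f (?p 0 h) - f (?p 0 0)) = h * ?Dv (?p s h) - h * ?Dv (?p s 0)"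
    by auto
  have "((\<lambda>t. ?Dv (?p s t)) has_derivative (\<lambda>c. c * frechet_derivative ?Dv (at (?p s t)) w)) (at t)"
    if "0 \<le> t" "t \<le> h" for t
    using line[of ?Dv "x + s *\<^sub>R v" t w 0] Df[of s t] that s by simp
  from mvt_simple[OF assms(3) has_derivative_at_withinI[OF this]]
  obtain t where t: "0 < t" "t < h" and
    2: "?Dv (?p s h) - ?Dv (?p s 0) = h * frechet_derivative ?Dv (at (?p s t)) w"
    by auto
  show thesis
  proof (rule that[of "?p s t"])
    show "dist x (?p s t) \<le> h * (norm v + norm w)"
      using d s t by simp
    have "f (x + h *\<^sub>R v + h *\<^sub>R w) - f (x + h *\<^sub>R v) - f (x + h *\<^sub>R w) + f x
        = h * (?Dv (?p s h) - ?Dv (?p s 0))"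
      using 1 by (simp add: right_diff_distrib)
    then show "f (x + h *\<^sub>R v + h *\<^sub>R w) - f (x + h *\<^sub>R v) - f (x + h *\<^sub>R w) + f x
        = h * h * frechet_derivative ?Dv (at (?p s t)) w"
      by (simp only: 2 mult.assoc)
  qed
qed

text \<open>The second difference is symmetric in \<open>v\<close> and \<open>w\<close>. Divided by
  the square of the step it is a value of either mixed derivative at a nearby point, and by
  continuity both tend to their values at \<open>x\<close>.\<close>

lemma symmetric_second_derivative_real:
  fixes f :: "'a::euclidean_space \<Rightarrow> real"
  assumes "smooth_on S f" "open S" "x \<in> S"
  shows "frechet_derivative (\<lambda>y. frechet_derivative f (at y) v) (at x) w =
    frechet_derivative (\<lambda>y. frechet_derivative f (at y) w) (at x) v"
proof -
  let ?D = "\<lambda>v w p. frechet_derivative (\<lambda>y. frechet_derivative f (at y) v) (at p) w"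
  obtain e where e: "e > 0" "ball x e \<subseteq> S"
    using assms(2,3) open_contains_ball by blast
  \<comment> \<open>The summand 1 keeps \<open>N\<close> positive and makes the bound on the size of
    the parallelogram strict.\<close>
  define N where "N = norm v + norm w + 1"
  define h where "h n = e / N * inverse (real (Suc n))" for n
  have N: "N > 0" by (simp add: N_def add_nonneg_pos)
  have h: "h n > 0" for n using e N by (simp add: h_def)
  have "h n * (norm v + norm w) < h n * N" for n
    using h by (simp add: N_def)
  moreover have "h n * N \<le> e" for n
    using N e mult_left_le[of "inverse (real (Suc n))" e] by (simp add: h_def inverse_le_1_iff)
  ultimately have he: "h n * (norm v + norm w) < e" for n
    using order_less_le_trans by blast
  have C: "Ck_on (Suc (Suc 0)) S f"
    using assms(1) smooth_on_def by blast
  have "\<exists>p q. dist x p \<le> h n * (norm v + norm w) \<and> dist x q \<le> h n * (norm v + norm w) \<and> ?D v w p = ?D w v q" for n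
  proof -
    obtain p where p: "dist x p \<le> h n * (norm v + norm w)"
      "f (x + h n *\<^sub>R v + h n *\<^sub>R w) - f (x + h n *\<^sub>R v) - f (x + h n *\<^sub>R w) + f x = h n * h n * ?D v w p"
      using second_difference[OF C e(2) h he] by blast
    obtain q where q: "dist x q \<le> h n * (norm w + norm v)"
      "f (x + h n *\<^sub>R w + h n *\<^sub>R v) - f (x + h n *\<^sub>R w) - f (x + h n *\<^sub>R v) + f x = h n * h n * ?D w v q"
      using second_difference[OF C e(2) h, of n w v] he by (metis add.commute)
    have "h n * h n * ?D v w p = h n * h n * ?D w v q"
      using p(2) q(2) by (simp add: algebra_simps)
    then show ?thesis
      using p q h[of n] by (auto simp: add.commute)
  qed
  then obtain p q where pq: "dist x (p n) \<le> h n * (norm v + norm w)"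
    "dist x (q n) \<le> h n * (norm v + norm w)" "?D v w (p n) = ?D w v (q n)" for n
    by metis
  have h0: "(\<lambda>n. h n * (norm v + norm w)) \<longlonglongrightarrow> 0"
    unfolding h_def using LIMSEQ_inverse_real_of_nat
    by (intro tendsto_mult_left_zero tendsto_mult_right_zero)
  have lim: "(\<lambda>n. ?D v' w' (z n)) \<longlonglongrightarrow> ?D v' w' x" if "\<And>n. dist x (z n) \<le> h n * (norm v + norm w)" for z v' w'
  proof -
    have "(\<lambda>n. dist (z n) x) \<longlonglongrightarrow> 0"
      by (rule tendsto_sandwich[OF _ _ tendsto_const h0]) (use that in \<open>auto simp: dist_commute\<close>)
    then have "z \<longlonglongrightarrow> x" by (rule tendsto_dist_iff[THEN iffD2])
    moreover have "isCont (?D v' w') x"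
      using C assms(2,3) by (simp add: continuous_on_eq_continuous_at)
    ultimately show ?thesis by (rule isCont_tendsto_compose[rotated])
  qed
  have "(\<lambda>n. ?D v w (p n)) \<longlonglongrightarrow> ?D v w x" "(\<lambda>n. ?D w v (q n)) \<longlonglongrightarrow> ?D w v x"
    by (rule lim[OF pq(1)], rule lim[OF pq(2)])
  then show ?thesis
    unfolding pq(3) by (rule LIMSEQ_unique)
qed

text \<open>Reduction to real functions: the inner product with a basis vector \<open>b\<close> is
  linear and passes through both derivatives.\<close>

lemma symmetric_second_derivative:
  fixes f :: "'a::euclidean_space \<Rightarrow> 'b::euclidean_space"
  assumes "smooth_on S f" "open S" "x \<in> S"
  shows "frechet_derivative (\<lambda>y. frechet_derivative f (at y) v) (at x) w =
    frechet_derivative (\<lambda>y. frechet_derivative f (at y) w) (at x) v"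
proof (rule euclidean_eqI)
  fix b :: 'b
  have inner: "frechet_derivative (\<lambda>y. g y \<bullet> b) (at y) z = frechet_derivative g (at y) z \<bullet> b"
    if "smooth_on S g" "y \<in> S" for g y z
    using has_derivative_inner_left[OF smooth_on_has_derivative[OF that]] frechet_derivative_at by metis
  have *: "frechet_derivative (\<lambda>y. frechet_derivative (\<lambda>y. f y \<bullet> b) (at y) v) (at x) w
      = frechet_derivative (\<lambda>y. frechet_derivative f (at y) v) (at x) w \<bullet> b" for v w
  proof -
    have "smooth_on S (\<lambda>y. frechet_derivative (\<lambda>y. f y \<bullet> b) (at y) v)"
      by (rule smooth_on_directional_derivative[OF
            smooth_on_bounded_linear[OF assms(2) bounded_linear_inner_left assms(1)]])
    note differentiableI[OF smooth_on_has_derivative[OF this assms(3)]]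
    then have "frechet_derivative (\<lambda>y. frechet_derivative (\<lambda>y. f y \<bullet> b) (at y) v) (at x)
      = frechet_derivative (\<lambda>y. frechet_derivative f (at y) v \<bullet> b) (at x)"
      by (rule frechet_derivative_transform_within_open[OF _ assms(2,3)]) (rule inner[OF assms(1)])
    then show ?thesis
      using inner[OF smooth_on_directional_derivative[OF assms(1)] assms(3)] by simp
  qed
  show "frechet_derivative (\<lambda>y. frechet_derivative f (at y) v) (at x) w \<bullet> b =
    frechet_derivative (\<lambda>y. frechet_derivative f (at y) w) (at x) v \<bullet> b"
    using symmetric_second_derivative_real[OF smooth_on_bounded_linear[OF assms(2) bounded_linear_inner_left assms(1)] assms(2,3)]
    by (simp only: *[symmetric])
qed

section \<open>The ring of operators on smooth spinor fields\<close>

abbreviation punctured :: "(real ^ 3) set" where "punctured \<equiv> - {0}"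

lemma smooth_on_uminus: "open S \<Longrightarrow> smooth_on S f \<Longrightarrow> smooth_on S (\<lambda>x. - f x)"
  by (rule smooth_on_bounded_linear[OF _ bounded_linear_minus[OF bounded_linear_ident]])

lemma smooth_on_diff:
  "open S \<Longrightarrow> smooth_on S f \<Longrightarrow> smooth_on S g \<Longrightarrow> smooth_on S (\<lambda>x. f x - g x)"
  using smooth_on_add[OF _ _ smooth_on_uminus, of S f g] by simp

lemma bounded_linear_matrix_complex: "bounded_linear (\<lambda>v. M *v v)" for M :: "complex ^ 'n ^ 'm"
  unfolding linear_conv_bounded_linear[symmetric]
  by (rule linearI) (simp_all add: vec_eq_iff matrix_vector_mult_def scaleR_sum_right
      algebra_simps sum.distrib)

lemma bounded_linear_vec_scale: "bounded_linear (\<lambda>v. c *s v)" for c :: complex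
  unfolding linear_conv_bounded_linear[symmetric]
  by (rule linearI) (simp_all add: vec_eq_iff algebra_simps)

text \<open>The value at the origin is pinned to 0, so that equality of fields is equality on the punctured space.\<close>

typedef sfield = "{\<psi> :: spinor_field. smooth_on punctured \<psi> \<and> \<psi> 0 = 0}"
  morphisms fld Sfield
  by (rule exI[of _ "\<lambda>x. 0"]) (simp add: smooth_on_const open_punctured)

setup_lifting type_definition_sfield

lemma smooth_fld: "smooth_on punctured (fld f)"
  using fld by auto

lemma fld_0 [simp]: "fld f 0 = 0"
  using fld by auto

lemma sfield_eqI: "(\<And>x. x \<noteq> 0 \<Longrightarrow> fld f x = fld g x) \<Longrightarrow> f = g"
  by (metis fld_0 fld_inject ext)

instantiation sfield :: ab_group_add
begin

lift_definition zero_sfield :: sfield is "\<lambda>x. 0"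
  by (simp add: smooth_on_const open_punctured)
lift_definition plus_sfield :: "sfield \<Rightarrow> sfield \<Rightarrow> sfield" is "\<lambda>f g x. f x + g x"
  by (simp add: smooth_on_add open_punctured)
lift_definition minus_sfield :: "sfield \<Rightarrow> sfield \<Rightarrow> sfield" is "\<lambda>f g x. f x - g x"
  by (simp add: smooth_on_diff open_punctured)
lift_definition uminus_sfield :: "sfield \<Rightarrow> sfield" is "\<lambda>f x. - f x"
  by (simp add: smooth_on_uminus open_punctured)

instance
  by standard (transfer; simp add: fun_eq_iff algebra_simps)+

end

lift_definition scale_sfield :: "complex \<Rightarrow> sfield \<Rightarrow> sfield" is "\<lambda>c f x. c *s f x"
  using smooth_on_bounded_linear[OF open_punctured bounded_linear_vec_scale] by auto

lemmas fld_simps [simp] = zero_sfield.rep_eq plus_sfield.rep_eq minus_sfield.rep_eq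
  uminus_sfield.rep_eq scale_sfield.rep_eq

lemma scale_sfield_add: "scale_sfield c (f + g) = scale_sfield c f + scale_sfield c g"
  by (rule sfield_eqI) (simp add: vec_eq_iff algebra_simps)

lemma scale_sfield_minus: "scale_sfield c (- f) = - scale_sfield c f"
  by (rule sfield_eqI) (simp add: vec_eq_iff algebra_simps)

lemma scale_sfield_diff: "scale_sfield c (f - g) = scale_sfield c f - scale_sfield c g"
  by (rule sfield_eqI) (simp add: vec_eq_iff algebra_simps)

lemma scale_sfield_0: "scale_sfield c 0 = 0"
  by (rule sfield_eqI) (simp add: vec_eq_iff)

lemma smooth_on_cutoff:
  fixes \<psi> :: "real ^ 3 \<Rightarrow> 'b::real_normed_vector"
  assumes "smooth_on punctured \<psi>"
  shows "smooth_on punctured (\<lambda>x. if x = 0 then 0 else \<psi> x)"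
  by (rule smooth_on_cong[OF open_punctured _ assms]) simp

text \<open>Fields that are not smooth go to the zero field, a default that makes the map
  total.\<close>

lift_definition restrict_field :: "spinor_field \<Rightarrow> sfield" is
  "\<lambda>\<psi>. if smooth_on punctured \<psi> then \<lambda>x. if x = 0 then 0 else \<psi> x else (\<lambda>x. 0)"
  by (simp add: smooth_on_const open_punctured smooth_on_cutoff)

lemma fld_restrict_field: "smooth_on punctured \<psi> \<Longrightarrow> x \<noteq> 0 \<Longrightarrow> fld (restrict_field \<psi>) x = \<psi> x"
  by (simp add: restrict_field.rep_eq)

text \<open>Additivity gives the distributive laws of the ring, and complex homogeneity makes the
  scalars \<open>sc c\<close> central.\<close>

typedef endo = "{T :: sfield \<Rightarrow> sfield. (\<forall>f g. T (f + g) = T f + T g) \<and>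
    (\<forall>c f. T (scale_sfield c f) = scale_sfield c (T f))}"
  morphisms app Endo
  by (rule exI[of _ id]) simp

setup_lifting type_definition_endo

lemma app_add: "app T (f + g) = app T f + app T g"
  and app_scale: "app T (scale_sfield c f) = scale_sfield c (app T f)"
  using app[of T] by auto

lemma app_0: "app T 0 = 0"
  using app_add[of T 0 0] by simp

instantiation endo :: ring_1
begin

lift_definition zero_endo :: endo is "\<lambda>f. 0"
  by (simp add: scale_sfield_0)
lift_definition one_endo :: endo is "\<lambda>f. f"
  by simp
lift_definition plus_endo :: "endo \<Rightarrow> endo \<Rightarrow> endo" is "\<lambda>T U f. T f + U f"
  by (simp add: scale_sfield_add)
lift_definition minus_endo :: "endo \<Rightarrow> endo \<Rightarrow> endo" is "\<lambda>T U f. T f - U f"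
  by (simp add: scale_sfield_diff)
lift_definition uminus_endo :: "endo \<Rightarrow> endo" is "\<lambda>T f. - T f"
  by (simp add: scale_sfield_minus)
lift_definition times_endo :: "endo \<Rightarrow> endo \<Rightarrow> endo" is "\<lambda>T U f. T (U f)"
  by simp

instance
proof
  fix T U V :: endo
  show "T * U * V = T * (U * V)" "1 * T = T" "T * 1 = T" "T + U + V = T + (U + V)" "T + U = U + T"
    "0 + T = T" "- T + T = 0" "T - U = T + - U" "(T + U) * V = T * V + U * V"
    by (transfer; simp add: fun_eq_iff)+
  show "T * (U + V) = T * U + T * V"
    by transfer simp
  show "(0 :: endo) \<noteq> 1"
  proof
    assume "(0 :: endo) = 1"
    \<comment> \<open>The identity is told apart from zero by the constant field with all components
      1, evaluated at a unit vector away from the origin.\<close>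
    then have "restrict_field (\<lambda>x. \<chi> i. 1) = 0"
      by (metis one_endo.rep_eq zero_endo.rep_eq)
    moreover have "fld (restrict_field (\<lambda>x. \<chi> i. 1)) (axis 1 1) = (\<chi> i. 1)"
      by (simp add: fld_restrict_field smooth_on_const open_punctured axis_eq_0_iff)
    ultimately show False
      by (simp add: vec_eq_iff)
  qed
qed

end

lemmas app_simps [simp] = zero_endo.rep_eq one_endo.rep_eq plus_endo.rep_eq minus_endo.rep_eq
  uminus_endo.rep_eq times_endo.rep_eq

lemma endo_eqI: "(\<And>f x. x \<noteq> 0 \<Longrightarrow> fld (app T f) x = fld (app U f) x) \<Longrightarrow> T = U"
  by (metis app_inject sfield_eqI ext)

text \<open>These are the properties that make an operator act on \<open>sfield\<close>; the second one says that junk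
  values at the origin do not matter.\<close>

definition admissible :: "spinor_op \<Rightarrow> bool" where
  "admissible T \<longleftrightarrow>
     (\<forall>\<psi>. smooth_on punctured \<psi> \<longrightarrow> smooth_on punctured (T \<psi>)) \<and>
     (\<forall>\<phi> \<psi> x. smooth_on punctured \<phi> \<longrightarrow> smooth_on punctured \<psi> \<longrightarrow>
        (\<forall>y. y \<noteq> 0 \<longrightarrow> \<phi> y = \<psi> y) \<longrightarrow> x \<noteq> 0 \<longrightarrow> T \<phi> x = T \<psi> x) \<and>
     (\<forall>\<phi> \<psi> x. smooth_on punctured \<phi> \<longrightarrow> smooth_on punctured \<psi> \<longrightarrow> x \<noteq> 0 \<longrightarrow>
        T (\<lambda>y. \<phi> y + \<psi> y) x = T \<phi> x + T \<psi> x) \<and>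
     (\<forall>c \<phi> x. smooth_on punctured \<phi> \<longrightarrow> x \<noteq> 0 \<longrightarrow> T (\<lambda>y. c *s \<phi> y) x = c *s T \<phi> x)"

lemma
  assumes "admissible T"
  shows admissible_smooth: "smooth_on punctured \<psi> \<Longrightarrow> smooth_on punctured (T \<psi>)"
    and admissible_local: "smooth_on punctured \<phi> \<Longrightarrow> smooth_on punctured \<psi> \<Longrightarrow>
        (\<And>y. y \<noteq> 0 \<Longrightarrow> \<phi> y = \<psi> y) \<Longrightarrow> x \<noteq> 0 \<Longrightarrow> T \<phi> x = T \<psi> x"
    and admissible_add: "smooth_on punctured \<phi> \<Longrightarrow> smooth_on punctured \<psi> \<Longrightarrow> x \<noteq> 0 \<Longrightarrow>
        T (\<lambda>y. \<phi> y + \<psi> y) x = T \<phi> x + T \<psi> x"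
    and admissible_scale: "smooth_on punctured \<phi> \<Longrightarrow> x \<noteq> 0 \<Longrightarrow> T (\<lambda>y. c *s \<phi> y) x = c *s T \<phi> x"
  using assms unfolding admissible_def by blast+

text \<open>\<open>restrict_field\<close> resets the value at the origin to 0. For admissible
  \<open>T\<close> the resulting map is linear, so that \<open>Endo\<close> represents it
  faithfully.\<close>

definition endo_of :: "spinor_op \<Rightarrow> endo" where
  "endo_of T = Endo (\<lambda>f. restrict_field (T (fld f)))"

lemma fld_app_endo_of:
  assumes T: "admissible T" and x: "x \<noteq> 0"
  shows "fld (app (endo_of T) f) x = T (fld f) x"
proof -
  have r: "fld (restrict_field (T \<psi>)) x = T \<psi> x" if "smooth_on punctured \<psi>" "x \<noteq> 0" for \<psi> x
    by (rule fld_restrict_field[OF admissible_smooth[OF T that(1)] that(2)])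
  have "restrict_field (T (fld (f + g))) = restrict_field (T (fld f)) + restrict_field (T (fld g))" for f g
    by (rule sfield_eqI) (simp add: r smooth_fld smooth_on_add open_punctured admissible_add[OF T])
  moreover have "restrict_field (T (fld (scale_sfield c f))) = scale_sfield c (restrict_field (T (fld f)))" for c f
    by (rule sfield_eqI)
      (simp add: r smooth_fld smooth_on_bounded_linear[OF open_punctured bounded_linear_vec_scale] admissible_scale[OF T])
  ultimately have "app (endo_of T) f = restrict_field (T (fld f))"
    unfolding endo_of_def by (subst Endo_inverse) simp_all
  then show ?thesis
    by (simp add: r smooth_fld x)
qed

lemma endo_of_eqI: "admissible T \<Longrightarrow> (\<And>f x. x \<noteq> 0 \<Longrightarrow> T (fld f) x = fld (app E f) x) \<Longrightarrow> endo_of T = E"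
  by (rule endo_eqI) (simp add: fld_app_endo_of)

text \<open>The way back from the ring to operators: off the origin, an admissible operator cannot
  distinguish a smooth field from its restriction, so equality on \<open>sfield\<close>
  suffices.\<close>

lemma op_eqI:
  assumes "admissible T" "admissible U" "endo_of T = endo_of U"
  shows "T \<doteq> U"
  unfolding op_eq_def
proof (intro allI impI)
  fix \<psi> :: spinor_field and x :: "real ^ 3"
  assume \<psi>: "smooth_on punctured \<psi>" and x: "x \<noteq> 0"
  let ?f = "restrict_field \<psi>"
  have "V \<psi> x = fld (app (endo_of V) ?f) x" if "admissible V" for V
    unfolding fld_app_endo_of[OF that x]
    by (rule admissible_local[OF that \<psi> smooth_fld _ x]) (simp add: fld_restrict_field[OF \<psi>])
  from this[OF assms(1)] this[OF assms(2)] show "T \<psi> x = U \<psi> x"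
    by (simp add: assms(3))
qed

lemma admissibleI:
  assumes "\<And>\<psi>. smooth_on punctured \<psi> \<Longrightarrow> smooth_on punctured (T \<psi>)"
    and "\<And>\<phi> \<psi> x. smooth_on punctured \<phi> \<Longrightarrow> smooth_on punctured \<psi> \<Longrightarrow>
        (\<And>y. y \<noteq> 0 \<Longrightarrow> \<phi> y = \<psi> y) \<Longrightarrow> x \<noteq> 0 \<Longrightarrow> T \<phi> x = T \<psi> x"
    and "\<And>\<phi> \<psi> x. smooth_on punctured \<phi> \<Longrightarrow> smooth_on punctured \<psi> \<Longrightarrow> x \<noteq> 0 \<Longrightarrow>
        T (\<lambda>y. \<phi> y + \<psi> y) x = T \<phi> x + T \<psi> x"
    and "\<And>c \<phi> x. smooth_on punctured \<phi> \<Longrightarrow> x \<noteq> 0 \<Longrightarrow> T (\<lambda>y. c *s \<phi> y) x = c *s T \<phi> x"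
  shows "admissible T"
  unfolding admissible_def using assms by blast

lemma smooth_on_vec_scale:
  "open S \<Longrightarrow> smooth_on S f \<Longrightarrow> smooth_on S (\<lambda>y. c *s f y)" for f :: "_ \<Rightarrow> complex ^ 'n"
  by (rule smooth_on_bounded_linear[OF _ bounded_linear_vec_scale])

text \<open>\<open>U\<close> respects sums and scalars only off the origin; that \<open>T\<close>
  ignores the values at the origin turns this into linearity of the product.\<close>

lemma admissible_comp [simp]:
  assumes T: "admissible T" and U: "admissible U"
  shows "admissible (T \<odot> U)"
  unfolding o_def
proof (rule admissibleI)
  note s = admissible_smooth[OF T] admissible_smooth[OF U]
  note sc = smooth_on_vec_scale[OF open_punctured]
  fix \<phi> \<psi> :: spinor_field and x :: "real ^ 3" and c :: complex
  assume \<phi>: "smooth_on punctured \<phi>"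
  show "smooth_on punctured (T (U \<phi>))"
    by (intro s \<phi>)
  assume x: "x \<noteq> 0"
  have "T (U (\<lambda>y. c *s \<phi> y)) x = T (\<lambda>y. c *s U \<phi> y) x"
    by (rule admissible_local[OF T s(2)[OF sc[OF \<phi>]] sc[OF s(2)[OF \<phi>]] _ x]) (rule admissible_scale[OF U \<phi>])
  then show "T (U (\<lambda>y. c *s \<phi> y)) x = c *s T (U \<phi>) x"
    by (simp only: admissible_scale[OF T s(2)[OF \<phi>] x])
  assume \<psi>: "smooth_on punctured \<psi>"
  have "T (U (\<lambda>y. \<phi> y + \<psi> y)) x = T (\<lambda>y. U \<phi> y + U \<psi> y) x"
    by (rule admissible_local[OF T s(2)[OF smooth_on_add[OF open_punctured \<phi> \<psi>]]
          smooth_on_add[OF open_punctured s(2)[OF \<phi>] s(2)[OF \<psi>]] _ x]) (rule admissible_add[OF U \<phi> \<psi>])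
  then show "T (U (\<lambda>y. \<phi> y + \<psi> y)) x = T (U \<phi>) x + T (U \<psi>) x"
    by (simp only: admissible_add[OF T s(2)[OF \<phi>] s(2)[OF \<psi>] x])
next
  fix \<phi> \<psi> :: spinor_field and x :: "real ^ 3"
  assume \<phi>: "smooth_on punctured \<phi>" and \<psi>: "smooth_on punctured \<psi>" and x: "x \<noteq> 0"
    and eq: "\<And>y. y \<noteq> 0 \<Longrightarrow> \<phi> y = \<psi> y"
  have "U \<phi> y = U \<psi> y" if "y \<noteq> 0" for y
    by (rule admissible_local[OF U \<phi> \<psi> eq that])
  then show "T (U \<phi>) x = T (U \<psi>) x"
    by (rule admissible_local[OF T admissible_smooth[OF U \<phi>] admissible_smooth[OF U \<psi>] _ x])
qed

lemma admissible_plus [simp]: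
  assumes T: "admissible T" and U: "admissible U"
  shows "admissible (T + U)"
proof (rule admissibleI)
  show "(T + U) \<phi> x = (T + U) \<psi> x" if "smooth_on punctured \<phi>" "smooth_on punctured \<psi>"
    "\<And>y. y \<noteq> 0 \<Longrightarrow> \<phi> y = \<psi> y" "x \<noteq> 0" for \<phi> \<psi> x
    using admissible_local[OF T that] admissible_local[OF U that] by simp
qed (simp_all add: admissible_add[OF T] admissible_add[OF U] admissible_scale[OF T] admissible_scale[OF U]
    plus_fun_def smooth_on_add open_punctured admissible_smooth[OF T] admissible_smooth[OF U] vector_add_ldistrib)

lemma admissible_op_scale [simp]:
  assumes T: "admissible T"
  shows "admissible (c \<cdot> T)"
proof (rule admissibleI)
  show "(c \<cdot> T) \<phi> x = (c \<cdot> T) \<psi> x" if "smooth_on punctured \<phi>" "smooth_on punctured \<psi>"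
    "\<And>y. y \<noteq> 0 \<Longrightarrow> \<phi> y = \<psi> y" "x \<noteq> 0" for \<phi> \<psi> x
    using admissible_local[OF T that] by (simp add: op_scale_def)
qed (simp_all add: admissible_add[OF T] admissible_scale[OF T] op_scale_def mult.commute
    smooth_on_vec_scale open_punctured admissible_smooth[OF T] vector_add_ldistrib)

lemma op_uminus_eq: "- T = (- 1) \<cdot> T" for T :: spinor_op
  by (simp add: op_scale_def fun_eq_iff)

lemma op_diff_eq: "T - U = T + (- 1) \<cdot> U" for T U :: spinor_op
  by (simp add: op_scale_def fun_eq_iff)

lemma admissible_uminus [simp]: "admissible T \<Longrightarrow> admissible (- T)"
  by (simp add: op_uminus_eq)

lemma admissible_diff [simp]: "admissible T \<Longrightarrow> admissible U \<Longrightarrow> admissible (T - U)"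
  by (simp add: op_diff_eq)

lemma admissible_0 [simp]: "admissible 0"
  by (rule admissibleI) (simp_all add: zero_fun_def smooth_on_const open_punctured)

lemma admissible_id [simp]: "admissible id"
  by (rule admissibleI) simp_all

lemma admissible_mult_op [simp]: "smooth_on punctured f \<Longrightarrow> admissible (mult_op f)"
  by (rule admissibleI)
     (simp_all add: mult_op_def scaleR_add_right smooth_on_scaleR open_punctured vec_eq_iff)

lemma admissible_matrix_op [simp]: "admissible (matrix_op M)"
  by (rule admissibleI)
     (simp_all add: matrix_op_def matrix_vector_right_distrib vector_scalar_commute
       smooth_on_bounded_linear[OF open_punctured bounded_linear_matrix_complex])

lemma admissible_partial [simp]: "admissible (partial k)"
proof (rule admissibleI)
  fix \<phi> \<psi> :: spinor_field and x :: "real ^ 3" and c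
  assume \<phi>: "smooth_on punctured \<phi>"
  show "smooth_on punctured (partial k \<phi>)"
    unfolding partial_def by (rule smooth_on_directional_derivative[OF \<phi>])
  assume x: "x \<noteq> 0"
  have \<phi>': "(\<phi> has_derivative frechet_derivative \<phi> (at x)) (at x)"
    using x by (intro smooth_on_has_derivative[OF \<phi>]) simp
  show "partial k (\<lambda>y. c *s \<phi> y) x = c *s partial k \<phi> x"
    unfolding partial_def
    by (rule fun_cong[OF frechet_derivative_at
          [OF bounded_linear.has_derivative[OF bounded_linear_vec_scale \<phi>']], symmetric])
  assume \<psi>: "smooth_on punctured \<psi>"
  then have \<psi>': "(\<psi> has_derivative frechet_derivative \<psi> (at x)) (at x)"
    using x by (intro smooth_on_has_derivative[OF \<psi>]) simp
  show "partial k (\<lambda>y. \<phi> y + \<psi> y) x = partial k \<phi> x + partial k \<psi> x"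
    unfolding partial_def
    by (rule fun_cong[OF frechet_derivative_at[OF has_derivative_add[OF \<phi>' \<psi>']], symmetric])
next
  fix \<phi> \<psi> :: spinor_field and x :: "real ^ 3"
  assume \<phi>: "smooth_on punctured \<phi>" and x: "x \<noteq> 0" and eq: "\<And>y. y \<noteq> 0 \<Longrightarrow> \<phi> y = \<psi> y"
  have "frechet_derivative \<phi> (at x) = frechet_derivative \<psi> (at x)"
    by (rule frechet_derivative_transform_within_open
        [OF differentiableI[OF smooth_on_has_derivative[OF \<phi>]] open_punctured])
      (use x eq in auto)
  then show "partial k \<phi> x = partial k \<psi> x"
    by (simp add: partial_def)
qed

lemma endo_of_comp: "admissible T \<Longrightarrow> admissible U \<Longrightarrow> endo_of (T \<odot> U) = endo_of T * endo_of U"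
  by (rule endo_of_eqI)
     (simp_all add: fld_app_endo_of admissible_local[OF _ admissible_smooth[OF _ smooth_fld] smooth_fld])

lemma endo_of_plus: "admissible T \<Longrightarrow> admissible U \<Longrightarrow> endo_of (T + U) = endo_of T + endo_of U"
  by (rule endo_of_eqI) (simp_all add: fld_app_endo_of)

lemma endo_of_diff: "admissible T \<Longrightarrow> admissible U \<Longrightarrow> endo_of (T - U) = endo_of T - endo_of U"
  by (rule endo_of_eqI) (simp_all add: fld_app_endo_of)

lemma endo_of_uminus: "admissible T \<Longrightarrow> endo_of (- T) = - endo_of T"
  by (rule endo_of_eqI) (simp_all add: fld_app_endo_of)

lemma endo_of_0: "endo_of 0 = 0"
  by (rule endo_of_eqI) simp_all

lemma endo_of_id: "endo_of id = 1"
  by (rule endo_of_eqI) simp_all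

lift_definition sc :: "complex \<Rightarrow> endo" is scale_sfield
  by (auto simp: scale_sfield_add intro!: sfield_eqI simp: vec_eq_iff)

lemma endo_of_op_scale: "admissible T \<Longrightarrow> endo_of (c \<cdot> T) = sc c * endo_of T"
  by (rule endo_of_eqI) (simp, simp add: fld_app_endo_of sc.rep_eq op_scale_def)

lemma sc_commute: "T * sc c = sc c * T"
  by (rule endo_eqI) (simp add: sc.rep_eq app_scale)

lemma sc_mult: "sc (b * c) = sc b * sc c"
  and sc_add: "sc (b + c) = sc b + sc c"
  and sc_minus: "sc (- c) = - sc c"
  and sc_1: "sc 1 = 1" and sc_0: "sc 0 = 0"
  by (rule endo_eqI; simp add: sc.rep_eq vec_eq_iff algebra_simps)+

lemma sc_numeral: "sc (numeral n) = numeral n"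
  by (induction n) (simp_all only: numeral.simps sc_1 sc_add)

section \<open>The concrete operators\<close>

lemma endo_of_cong:
  assumes "admissible T" "admissible U" "T \<doteq> U"
  shows "endo_of T = endo_of U"
  by (rule endo_of_eqI[OF assms(1)])
     (use assms(2,3) smooth_fld in \<open>simp add: fld_app_endo_of op_eq_def\<close>)

lemma op_prod_congI:
  assumes "admissible T" "admissible U" "admissible V" "admissible W" "T \<odot> U \<doteq> V \<odot> W"
  shows "endo_of T * endo_of U = endo_of V * endo_of W"
  using endo_of_cong[OF _ _ assms(5)] assms(1-4) by (simp add: endo_of_comp)

lemma smooth_on_nth: "smooth_on punctured (\<lambda>x. x $ k)"
  by (rule smooth_on_bounded_linear[OF open_punctured bounded_linear_vec_nth smooth_on_id[OF open_punctured]])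

lemma smooth_on_inverse_norm: "smooth_on punctured (\<lambda>x. 1 / norm x)"
  by (simp add: smooth_on_def divide_inverse Ck_on_inverse_norm)

lemma admissible_pos [simp]: "admissible (pos k)"
  by (simp add: pos_def smooth_on_nth)

lemma admissible_sigma [simp]: "admissible (sigma1 k)" "admissible (sigma2 k)"
  by (simp_all add: sigma1_def sigma2_def)

lemma endo_of_mult_op_mult:
  assumes "smooth_on punctured f" "smooth_on punctured g"
  shows "endo_of (mult_op f) * endo_of (mult_op g) = endo_of (mult_op (\<lambda>x. f x * g x))"
proof -
  have "mult_op f \<odot> mult_op g = mult_op (\<lambda>x. f x * g x)"
    by (simp add: mult_op_def fun_eq_iff)
  then show ?thesis
    using assms by (simp flip: endo_of_comp)
qed

lemma endo_of_mult_op_cong: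
  assumes "smooth_on punctured f" "\<And>x. x \<noteq> 0 \<Longrightarrow> f x = g x"
  shows "endo_of (mult_op f) = endo_of (mult_op g)"
proof -
  have "smooth_on punctured g"
    by (rule smooth_on_cong[OF open_punctured _ assms(1)]) (use assms(2) in simp)
  then show ?thesis
    using assms by (intro endo_of_cong admissible_mult_op) (simp_all add: op_eq_def mult_op_def)
qed

lemma endo_of_mult_op_const: "endo_of (mult_op (\<lambda>x. c)) = sc (of_real c)"
  by (rule endo_of_eqI, simp add: smooth_on_const open_punctured)
     (simp add: mult_op_def sc.rep_eq vec_eq_iff scaleR_conv_of_real[of _ "_ :: complex"])

lemma mult_op_matrix_commute:
  assumes "smooth_on punctured f"
  shows "endo_of (matrix_op M) * endo_of (mult_op f) = endo_of (mult_op f) * endo_of (matrix_op M)"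
  by (rule op_prod_congI[OF admissible_matrix_op admissible_mult_op[OF assms]
        admissible_mult_op[OF assms] admissible_matrix_op])
     (simp add: op_eq_def matrix_op_def mult_op_def vec_eq_iff matrix_vector_mult_def scaleR_sum_right)

lemma partial_matrix_commute:
  "endo_of (matrix_op M) * endo_of (partial k) = endo_of (partial k) * endo_of (matrix_op M)"
proof (rule op_prod_congI)
  show "matrix_op M \<odot> partial k \<doteq> partial k \<odot> matrix_op M"
    unfolding op_eq_def
  proof (intro allI impI)
    fix \<psi> :: spinor_field and x :: "real ^ 3"
    assume "smooth_on punctured \<psi>" "x \<noteq> 0"
    then have "(\<psi> has_derivative frechet_derivative \<psi> (at x)) (at x)"
      by (intro smooth_on_has_derivative) auto
    from fun_cong[OF frechet_derivative_at[OF bounded_linear.has_derivative[OF bounded_linear_matrix_complex this]]]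
    show "(matrix_op M \<odot> partial k) \<psi> x = (partial k \<odot> matrix_op M) \<psi> x"
      by (simp add: matrix_op_def partial_def)
  qed
qed simp_all

lemma partial_commute: "endo_of (partial j) * endo_of (partial k) = endo_of (partial k) * endo_of (partial j)"
proof (rule op_prod_congI)
  show "partial j \<odot> partial k \<doteq> partial k \<odot> partial j"
    unfolding op_eq_def o_def partial_def
    by (intro allI impI symmetric_second_derivative[OF _ open_punctured]) auto
qed simp_all

text \<open>The Leibniz rule as an operator identity. It supplies the canonical commutation
  relations and the gradients of the inverse radius and of the potentials.\<close>

lemma partial_mult_op:
  assumes f: "smooth_on punctured f" and g: "smooth_on punctured g"
    and fg: "\<And>x. x \<noteq> 0 \<Longrightarrow> frechet_derivative f (at x) (axis k 1) = g x"
  shows "endo_of (partial k) * endo_of (mult_op f) =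
    endo_of (mult_op f) * endo_of (partial k) + endo_of (mult_op g)"
proof -
  have "partial k \<odot> mult_op f \<doteq> mult_op f \<odot> partial k + mult_op g"
    unfolding op_eq_def
  proof (intro allI impI)
    fix \<psi> :: spinor_field and x :: "real ^ 3"
    assume \<psi>: "smooth_on punctured \<psi>" and x: "x \<noteq> 0"
    from fun_cong[OF frechet_derivative_at[OF has_derivative_scaleR
        [OF smooth_on_has_derivative[OF f] smooth_on_has_derivative[OF \<psi>]]], of x "axis k 1"] x
    show "(partial k \<odot> mult_op f) \<psi> x = (mult_op f \<odot> partial k + mult_op g) \<psi> x"
      by (simp add: mult_op_def partial_def fg[OF x])
  qed
  from endo_of_cong[OF _ _ this] f g show ?thesis
    by (simp add: endo_of_comp endo_of_plus)
qed

text \<open>The Pauli matrices are rescaled to quaternion units, and the derivatives are used in place of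
  the momenta, so that neither \<open>\<i>\<close> nor \<open>\<hbar>\<close> occurs in the relations between the generators.\<close>

definition xs where "xs k = endo_of (pos k)"
definition ds where "ds k = endo_of (partial k)"
definition us where "us k = sc (- \<i>) * endo_of (sigma1 k)"
definition vs where "vs k = sc (- \<i>) * endo_of (sigma2 k)"
definition rho where "rho = endo_of (mult_op (\<lambda>x. 1 / norm x))"

text \<open>The gradient of a function of the radius is parallel to \<open>x\<close>;
  \<open>g\<close> is the radial derivative of \<open>V\<close> divided by the radius and serves as
  the witness in \<open>E.radial\<close>.\<close>

lemma partial_comp_norm:
  assumes V: "smooth_on {0<..} V"
  defines "g \<equiv> \<lambda>x::real^3. frechet_derivative V (at (norm x)) 1 * (1 / norm x)"
  shows "ds k * endo_of (mult_op (\<lambda>x. V (norm x)))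
    = endo_of (mult_op (\<lambda>x. V (norm x))) * ds k + xs k * endo_of (mult_op g)"
proof -
  have g: "smooth_on punctured g"
    unfolding g_def using smooth_on_comp_norm[OF smooth_on_directional_derivative[OF V]]
    by (intro smooth_on_mult open_punctured smooth_on_inverse_norm)
  have "ds k * endo_of (mult_op (\<lambda>x. V (norm x))) = endo_of (mult_op (\<lambda>x. V (norm x))) * ds k + endo_of (mult_op (\<lambda>x. x $ k * g x))"
    unfolding ds_def
  proof (rule partial_mult_op)
    fix x :: "real ^ 3" assume x: "x \<noteq> 0"
    then have "(V has_derivative frechet_derivative V (at (norm x))) (at (norm x))"
      by (intro smooth_on_has_derivative[OF V]) simp
    from fun_cong[OF frechet_derivative_at[OF has_derivative_comp_norm[OF this x]], of "axis k 1"]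
    show "frechet_derivative (\<lambda>x. V (norm x)) (at x) (axis k 1) = x $ k * g x"
      by (simp add: g_def inner_axis divide_inverse algebra_simps)
  qed (intro smooth_on_comp_norm V smooth_on_mult open_punctured smooth_on_nth g)+
  then show ?thesis
    by (simp add: xs_def pos_def endo_of_mult_op_mult smooth_on_nth g)
qed

lemma rho_cube: "rho * rho * rho = endo_of (mult_op (\<lambda>x. 1 / norm x * (1 / norm x) * (1 / norm x)))"
  by (simp only: rho_def endo_of_mult_op_mult smooth_on_inverse_norm smooth_on_mult[OF open_punctured])

lemma partial_rho: "ds k * rho = rho * ds k - xs k * (rho * rho * rho)"
proof -
  have "ds k * rho = rho * ds k + endo_of (mult_op (\<lambda>x. - (x $ k * (1 / norm x * (1 / norm x) * (1 / norm x)))))"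
    unfolding ds_def rho_def
  proof (rule partial_mult_op)
    fix x :: "real ^ 3" assume x: "x \<noteq> 0"
    from fun_cong[OF frechet_derivative_at[OF Deriv.has_derivative_inverse[OF _ has_derivative_norm[OF x]]], of "axis k 1"] x
    show "frechet_derivative (\<lambda>x. 1 / norm x) (at x) (axis k 1)
        = - (x $ k * (1 / norm x * (1 / norm x) * (1 / norm x)))"
      by (simp add: inner_axis' sgn_div_norm divide_inverse algebra_simps)
  qed (intro smooth_on_uminus smooth_on_mult open_punctured smooth_on_nth smooth_on_inverse_norm)+
  also have "endo_of (mult_op (\<lambda>x. - (x $ k * (1 / norm x * (1 / norm x) * (1 / norm x)))))
      = - (xs k * (rho * rho * rho))"
  proof -
    have s: "smooth_on punctured (\<lambda>x. 1 / norm x * (1 / norm x) * (1 / norm x))"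
      by (intro smooth_on_mult open_punctured smooth_on_inverse_norm)
    have "mult_op (\<lambda>x. - (x $ k * (1 / norm x * (1 / norm x) * (1 / norm x))))
        = - (mult_op (\<lambda>x. x $ k * (1 / norm x * (1 / norm x) * (1 / norm x))))"
      by (simp add: mult_op_def fun_eq_iff)
    then show ?thesis
      unfolding rho_cube xs_def pos_def endo_of_mult_op_mult[OF smooth_on_nth s]
      by (simp only: endo_of_uminus admissible_mult_op smooth_on_mult[OF open_punctured smooth_on_nth s])
  qed
  finally show ?thesis by simp
qed

section \<open>Pauli matrices as quaternion units\<close>

lemma kronecker_mult:
  "kronecker A B ** kronecker C E = kronecker (A ** C) (B ** E)"
proof -
  have "(\<Sum>k\<in>UNIV. A $ a $ fst k * B $ b $ snd k * (C $ fst k $ c * E $ snd k $ e))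
      = (\<Sum>k\<in>UNIV. A $ a $ k * C $ k $ c) * (\<Sum>k\<in>UNIV. B $ b $ k * E $ k $ e)" for a b c e
    unfolding sum_product UNIV_Times_UNIV[symmetric]
    by (subst sum.cartesian_product) (auto intro!: sum.cong)
  then show ?thesis
    by (simp add: vec_eq_iff kronecker_def matrix_matrix_mult_def)
qed

lemma matrix_op_mult: "endo_of (matrix_op M) * endo_of (matrix_op N) = endo_of (matrix_op (M ** N))"
proof -
  have "matrix_op M \<odot> matrix_op N = matrix_op (M ** N)"
    by (simp add: matrix_op_def fun_eq_iff matrix_vector_mul_assoc)
  then show ?thesis
    by (simp flip: endo_of_comp)
qed

lemma matrix_op_mat_1: "endo_of (matrix_op (mat 1)) = 1"
  by (rule endo_of_eqI, simp) (simp add: matrix_op_def)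

lemma matrix_op_scale:
  "endo_of (matrix_op (kronecker (\<chi> i j. c * M $ i $ j) N)) = sc c * endo_of (matrix_op (kronecker M N))"
  "endo_of (matrix_op (kronecker M (\<chi> i j. c * N $ i $ j))) = sc c * endo_of (matrix_op (kronecker M N))"
  by (rule endo_of_eqI, simp, simp add: fld_app_endo_of sc.rep_eq, simp add: matrix_op_def kronecker_def vec_eq_iff
      matrix_vector_mult_def sum_distrib_left mult_ac)+

text \<open>The multiples are written entrywise so that \<open>matrix_op_scale\<close> can extract
  the scalar from either Kronecker factor.\<close>

lemma pauli_mult:
  "pauli k ** pauli k = mat 1"
  "pauli 1 ** pauli 2 = (\<chi> i j. \<i> * pauli 3 $ i $ j)" "pauli 2 ** pauli 1 = (\<chi> i j. - \<i> * pauli 3 $ i $ j)"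
  "pauli 2 ** pauli 3 = (\<chi> i j. \<i> * pauli 1 $ i $ j)" "pauli 3 ** pauli 2 = (\<chi> i j. - \<i> * pauli 1 $ i $ j)"
  "pauli 3 ** pauli 1 = (\<chi> i j. \<i> * pauli 2 $ i $ j)" "pauli 1 ** pauli 3 = (\<chi> i j. - \<i> * pauli 2 $ i $ j)"
  by (simp_all add: vec_eq_iff forall_2 matrix_matrix_mult_def sum_2 pauli_def mat_def)

lemma kronecker_mat_1: "kronecker (mat 1) (mat 1) = mat 1"
  by (auto simp: kronecker_def mat_def vec_eq_iff)

lemma sc_left: "T * (sc c * U) = sc c * (T * U)"
  by (metis sc_commute mult.assoc)

lemma sc_sc: "sc b * sc c = sc (b * c)" "sc b * (sc c * T) = sc (b * c) * T"
  by (simp_all add: sc_mult mult.assoc)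

lemmas endo_of_sc = sc_commute[of "endo_of T" for T] sc_left[of "endo_of T" for T]

text \<open>The two factors \<open>- \<i>\<close> multiply to -1, which turns the
  \<open>\<i>\<close> in a product of distinct Pauli matrices into the \<open>- \<i>\<close> of the
  third unit.\<close>

lemma quaternion_us: "quaternion_units us" and quaternion_vs: "quaternion_units vs"
  unfolding quaternion_units_def us_def vs_def sigma1_def sigma2_def
  by (simp_all add: mult.assoc endo_of_sc sc_sc matrix_op_mult kronecker_mult pauli_mult
      matrix_op_scale matrix_op_scale[where c = "- \<i>", simplified] kronecker_mat_1 matrix_op_mat_1 sc_minus sc_1)

lemma rho_matrix_commute: "rho * (sc c * endo_of (matrix_op M)) = sc c * endo_of (matrix_op M) * rho"
  by (simp add: rho_def endo_of_sc mult_op_matrix_commute smooth_on_inverse_norm mult.assoc)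

lemma endo_of_mult_op_add:
  assumes "smooth_on punctured f" "smooth_on punctured g"
  shows "endo_of (mult_op f) + endo_of (mult_op g) = endo_of (mult_op (\<lambda>x. f x + g x))"
proof -
  have "mult_op f + mult_op g = mult_op (\<lambda>x. f x + g x)"
    by (simp add: mult_op_def fun_eq_iff algebra_simps)
  then show ?thesis
    using assms by (simp flip: endo_of_plus)
qed

lemma smooth_on_norm_squared: "smooth_on punctured (\<lambda>x. (norm x)\<^sup>2)"
  and dot_xs_xs: "dot xs xs = endo_of (mult_op (\<lambda>x. (norm x)\<^sup>2))"
proof -
  have eq: "(norm x)\<^sup>2 = x $ 1 * x $ 1 + x $ 2 * x $ 2 + x $ 3 * x $ 3" for x :: "real ^ 3"
    by (simp add: power2_norm_eq_inner inner_vec_def sum_3)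
  show "smooth_on punctured (\<lambda>x. (norm x)\<^sup>2)"
    unfolding eq by (intro smooth_on_add smooth_on_mult open_punctured smooth_on_nth)
  show "dot xs xs = endo_of (mult_op (\<lambda>x. (norm x)\<^sup>2))"
    unfolding eq
    by (simp only: dot_3 xs_def pos_def endo_of_mult_op_mult endo_of_mult_op_add smooth_on_nth
        smooth_on_mult[OF open_punctured] smooth_on_add[OF open_punctured])
qed

lemma xs_xs_rho_rho: "dot xs xs * (rho * rho) = 1"
proof -
  have "dot xs xs * (rho * rho) = endo_of (mult_op (\<lambda>x. (norm x)\<^sup>2 * (1 / norm x * (1 / norm x))))"
    by (simp only: dot_xs_xs rho_def endo_of_mult_op_mult smooth_on_norm_squared smooth_on_inverse_norm
        smooth_on_mult[OF open_punctured])
  also have "\<dots> = endo_of (mult_op (\<lambda>x. 1))"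
  proof (rule endo_of_mult_op_cong)
    show "smooth_on punctured (\<lambda>x. (norm x)\<^sup>2 * (1 / norm x * (1 / norm x)))"
      by (intro smooth_on_mult open_punctured smooth_on_norm_squared smooth_on_inverse_norm)
  qed (simp add: power2_eq_square)
  finally show ?thesis
    by (simp add: endo_of_mult_op_const sc_1)
qed

lemma smooth_on_norm: "smooth_on punctured norm"
  using smooth_on_comp_norm[OF smooth_on_id, where ?'a = "real ^ 3"] by simp

text \<open>Expresses multiplication by the radius through \<open>rho\<close> and the positions, so
  that the tenth operator lies in the ring they generate with derivatives and spins.\<close>

lemma mult_op_norm: "endo_of (mult_op norm) = rho * dot xs xs"
proof -
  have "rho * dot xs xs = endo_of (mult_op (\<lambda>x. 1 / norm x * (norm x)\<^sup>2))"
    by (simp only: dot_xs_xs rho_def endo_of_mult_op_mult smooth_on_norm_squared smooth_on_inverse_norm)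
  also have "\<dots> = endo_of (mult_op norm)"
  proof (rule endo_of_mult_op_cong)
    show "smooth_on punctured (\<lambda>x. 1 / norm x * (norm x)\<^sup>2)"
      by (intro smooth_on_mult open_punctured smooth_on_norm_squared smooth_on_inverse_norm)
  qed (simp add: power2_eq_square)
  finally show ?thesis by simp
qed

text \<open>From here on, every identity of the abstract algebra is available for the operators on
  smooth spinor fields.\<close>

interpretation E: spin_pair xs ds us vs rho
proof
  fix j k :: 3
  show "xs j * xs k = xs k * xs j"
    by (simp add: xs_def pos_def endo_of_mult_op_mult smooth_on_nth mult.commute)
  show "ds j * ds k = ds k * ds j"
    by (simp add: ds_def partial_commute)
  show "ds j * xs k = xs k * ds j + (if j = k then 1 else 0)"
  proof -
    have "ds j * xs k = xs k * ds j + endo_of (mult_op (\<lambda>x. if j = k then 1 else 0))"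
      unfolding ds_def xs_def pos_def
    proof (rule partial_mult_op)
      fix x :: "real ^ 3"
      show "frechet_derivative (\<lambda>x. x $ k) (at x) (axis j 1) = (if j = k then 1 else 0)"
        unfolding frechet_derivative_at
          [OF bounded_linear_imp_has_derivative[OF bounded_linear_vec_nth], symmetric]
        by (simp add: axis_def)
    qed (simp_all add: smooth_on_nth smooth_on_const open_punctured)
    then show ?thesis
      by (simp add: endo_of_mult_op_const sc_1 sc_0)
  qed
  show "us j * xs k = xs k * us j" "vs j * xs k = xs k * vs j"
    by (simp_all add: us_def vs_def xs_def pos_def sigma1_def sigma2_def endo_of_sc mult.assoc
        mult_op_matrix_commute smooth_on_nth)
  show "us j * ds k = ds k * us j" "vs j * ds k = ds k * vs j"
    by (simp_all add: us_def vs_def ds_def sigma1_def sigma2_def endo_of_sc mult.assoc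
        partial_matrix_commute)
  show "vs j * us k = us k * vs j"
    by (simp add: us_def vs_def sigma1_def sigma2_def endo_of_sc mult.assoc sc_sc
        matrix_op_mult kronecker_mult)
  show "quaternion_units us" "quaternion_units vs"
    by (fact quaternion_us quaternion_vs)+
  show "rho * us k = us k * rho" "rho * vs k = vs k * rho"
    by (simp_all add: us_def vs_def sigma1_def sigma2_def rho_matrix_commute)
  show "rho * xs k = xs k * rho"
    by (simp add: rho_def xs_def pos_def endo_of_mult_op_mult smooth_on_nth smooth_on_inverse_norm mult.commute)
  show "ds k * rho = rho * ds k - xs k * (rho * rho * rho)"
    by (fact partial_rho)
  show "dot xs xs * (rho * rho) = 1"
    by (fact xs_xs_rho_rho)
qed

section \<open>Images of the integrals of motion in the ring\<close>

lemma op_inner_3: "op_inner X Y = X 1 \<odot> Y 1 + X 2 \<odot> Y 2 + X 3 \<odot> Y 3"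
  by (simp add: op_inner_def sum_3)

lemma admissible_op_inner [simp]:
  "(\<And>k. admissible (X k)) \<Longrightarrow> (\<And>k. admissible (Y k)) \<Longrightarrow> admissible (op_inner X Y)"
  by (simp add: op_inner_3)

lemma endo_of_op_inner:
  "(\<And>k. admissible (X k)) \<Longrightarrow> (\<And>k. admissible (Y k)) \<Longrightarrow>
    endo_of (op_inner X Y) = dot (\<lambda>k. endo_of (X k)) (\<lambda>k. endo_of (Y k))"
  by (simp add: op_inner_3 dot_3 endo_of_comp endo_of_plus)

lemma admissible_mom [simp]: "admissible (mom hbar k)"
  by (simp add: mom_def)

lemma admissible_ang [simp]: "admissible (ang hbar k)"
  by (simp add: ang_def op_cross_def)

lemma admissible_tot_ang [simp]: "admissible (tot_ang hbar k)"
  by (simp add: tot_ang_def)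

lemma admissible_sigma_sum [simp]: "admissible ((sigma1 + sigma2) k)"
  by simp

lemma admissible_radial [simp]:
  "admissible (mult_op (\<lambda>x. 1 / norm x))" "admissible (mult_op norm)"
  by (simp_all only: admissible_mult_op smooth_on_inverse_norm smooth_on_norm)

lemma dot_sc: "dot (\<lambda>k. sc c * X k) Y = sc c * dot X Y" "dot X (\<lambda>k. sc c * Y k) = sc c * dot X Y"
  by (simp_all add: dot_3 mult.assoc sc_left distrib_left)

lemma endo_of_sigma: "endo_of (sigma1 k) = sc \<i> * us k" "endo_of (sigma2 k) = sc \<i> * vs k"
  by (simp_all add: us_def vs_def sc_sc sc_1)

lemma endo_of_sigma_sum: "endo_of ((sigma1 + sigma2) k) = sc \<i> * E.t k"
  by (simp add: endo_of_plus endo_of_sigma distrib_left)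

lemma endo_of_mom: "endo_of (mom hbar k) = sc (- \<i> * of_real hbar) * ds k"
  by (simp add: mom_def endo_of_op_scale ds_def)

lemma endo_of_ang: "endo_of (ang hbar k) = sc (- \<i> * of_real hbar) * E.l k"
  by (simp add: ang_def op_cross_def E.l_def cross_def endo_of_diff endo_of_comp endo_of_mom
      xs_def[symmetric] sc_left right_diff_distrib)

text \<open>The factor 1/2 goes into the scalar, leaving the integral combination whose square is
  \<open>E.b_b\<close>.\<close>

lemma endo_of_tot_ang: "endo_of (tot_ang hbar k) = sc (- \<i> * of_real hbar / 2) * (2 * E.l k - E.t k)"
proof -
  have "sc (- \<i> * of_real hbar / 2) * (2 * E.l k) = sc (- \<i> * of_real hbar) * E.l k"
    unfolding sc_numeral[symmetric] sc_sc by simp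
  moreover have "endo_of (tot_ang hbar k) = sc (- \<i> * of_real hbar) * E.l k + sc (\<i> * of_real hbar / 2) * E.t k"
    by (simp add: tot_ang_def endo_of_plus endo_of_op_scale endo_of_ang endo_of_sigma sc_sc distrib_left mult.commute)
  ultimately show ?thesis
    by (simp add: right_diff_distrib sc_minus)
qed

lemma endo_of_K: "endo_of op_K = - E.\<kappa>"
  by (simp add: op_K_def endo_of_op_inner endo_of_sigma dot_sc sc_sc sc_minus sc_1 E.\<kappa>_def)

lemma endo_of_A: "endo_of (op_A hbar) = sc (of_real hbar) * E.a"
  by (simp only: op_A_def endo_of_op_inner admissible_sigma_sum admissible_ang endo_of_sigma_sum endo_of_ang dot_sc
      sc_sc E.a_def) simp

lemma endo_of_sX: "endo_of (op_inner (sigma1 + sigma2) pos) = sc \<i> * E.X"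
  by (simp only: endo_of_op_inner admissible_sigma_sum admissible_pos endo_of_sigma_sum xs_def[symmetric] dot_sc E.X_def)

lemma endo_of_Y8: "endo_of op_Y8 = sc \<i> * E.y"
  by (simp add: op_Y8_def endo_of_comp endo_of_sX E.y_def rho_def[symmetric] sc_left)

lemma endo_of_L2: "endo_of (op_L2 hbar) = sc (- (of_real hbar)\<^sup>2) * dot E.l E.l"
  by (simp add: op_L2_def endo_of_op_inner endo_of_ang dot_sc sc_sc power2_eq_square mult_ac)

lemma endo_of_J2: "endo_of (op_J2 hbar) = sc (- (of_real hbar)\<^sup>2 / 4) * (4 * dot E.l E.l - 4 * E.a + (2 * E.\<kappa> - 6))"
  by (simp add: op_J2_def endo_of_op_inner endo_of_tot_ang dot_sc sc_sc power2_eq_square mult_ac E.b_b)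

lemma endo_of_Y9: "endo_of (op_Y9 hbar) = - sc (\<i> * of_real hbar) * (E.y * E.a - E.Q + E.y)"
proof -
  have "endo_of (op_Y9 hbar) = - (rho * (dot (\<lambda>k. sc \<i> * us k) xs * dot (\<lambda>k. sc \<i> * vs k) (\<lambda>k. endo_of (ang hbar k))
      + dot (\<lambda>k. sc \<i> * vs k) xs * dot (\<lambda>k. sc \<i> * us k) (\<lambda>k. endo_of (ang hbar k))))"
    by (simp add: op_Y9_def endo_of_uminus endo_of_comp endo_of_plus endo_of_op_inner endo_of_sigma
        flip: rho_def xs_def)
  also have "\<dots> = - (sc (\<i> * of_real hbar) * (rho * (dot us xs * dot vs E.l + dot vs xs * dot us E.l)))"
    by (simp add: endo_of_ang dot_sc distrib_left mult.assoc sc_left[of "dot _ _"] sc_left[of rho] sc_sc)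
  finally show ?thesis
    by (simp only: E.\<rho>_mixed mult_minus_left)
qed

lemma i_mult_i_right: "\<i> * (c * \<i>) = - c"
  by (simp add: mult.commute[of c])

lemma endo_of_Y10: "endo_of (op_Y10 hbar) = sc (of_real hbar) * E.Q"
proof -
  have "endo_of (op_Y10 hbar) = rho * (sc \<i> * E.X) * (sc (- \<i> * of_real hbar) * E.D)
      - rho * dot xs xs * (sc \<i> * (sc (- \<i> * of_real hbar) * E.P))
      - sc (\<i> * of_real hbar) * (rho * (sc \<i> * E.X))"
    by (simp only: op_Y10_def endo_of_diff endo_of_comp endo_of_op_scale endo_of_sX mult_op_norm endo_of_op_inner
        admissible_comp admissible_diff admissible_op_scale admissible_radial admissible_op_inner
        admissible_pos admissible_mom admissible_sigma_sum endo_of_mom endo_of_sigma_sum dot_sc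
        rho_def[symmetric] xs_def[symmetric] E.D_def E.P_def)
  also have "\<dots> = sc (of_real hbar) * E.Q"
    by (simp add: i_mult_i_right E.Q_def E.q_def mult.assoc sc_left[of rho] sc_left[of "dot _ _"] sc_left[of E.X] sc_sc sc_minus
        distrib_left right_diff_distrib)
  finally show ?thesis .
qed

lemma admissible_generators [simp]:
  "admissible op_K" "admissible (op_A hbar)" "admissible op_Y8" "admissible (op_Y9 hbar)"
  "admissible (op_Y10 hbar)" "admissible (op_J2 hbar)" "admissible (op_L2 hbar)"
  unfolding op_K_def op_A_def op_Y8_def op_Y9_def op_Y10_def op_J2_def op_L2_def
  by (simp_all only: admissible_comp admissible_diff admissible_plus admissible_uminus admissible_op_scale
      admissible_radial admissible_op_inner admissible_pos admissible_mom admissible_sigma admissible_sigma_sum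
      admissible_ang admissible_tot_ang)

lemma admissible_commutator [simp]: "admissible T \<Longrightarrow> admissible U \<Longrightarrow> admissible (commutator T U)"
  by (simp add: commutator_def)

lemma endo_of_commutator: "admissible T \<Longrightarrow> admissible U \<Longrightarrow>
    endo_of (commutator T U) = endo_of T * endo_of U - endo_of U * endo_of T"
  by (simp add: commutator_def endo_of_diff endo_of_comp)

lemma commutator_eq_0:
  "admissible T \<Longrightarrow> admissible U \<Longrightarrow> commute (endo_of T) (endo_of U) \<Longrightarrow> commutator T U \<doteq> 0"
  by (rule op_eqI) (simp_all add: endo_of_commutator endo_of_0 commute_def)

lemma commute_sc [simp]: "commute (sc c) T" "commute T (sc c)"
  by (simp_all add: commute_def sc_commute)

lemma commute_uminus: "commute T U \<Longrightarrow> commute T (- U)" for T :: "'a::ring_1"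
  by (simp add: commute_def)

section \<open>Commutation with functions of the radius and with the Hamiltonian\<close>

abbreviation radial_mult :: "(real \<Rightarrow> real) \<Rightarrow> endo" where
  "radial_mult V \<equiv> endo_of (mult_op (\<lambda>x. V (norm x)))"

context
  fixes V :: "real \<Rightarrow> real"
  assumes V: "smooth_on {0<..} V"
begin

lemma commute_radial_mult_mult_op: "smooth_on punctured f \<Longrightarrow> commute (radial_mult V) (endo_of (mult_op f))"
  by (simp add: commute_def endo_of_mult_op_mult smooth_on_comp_norm V mult.commute)

lemma commute_radial_mult_sigma: "commute (radial_mult V) (us k)" "commute (radial_mult V) (vs k)"
  unfolding us_def vs_def sigma1_def sigma2_def
  by (simp_all add: commute_mult commute_def mult_op_matrix_commute smooth_on_comp_norm V endo_of_sc mult.assoc)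

lemma admissible_mult_op_comp_norm [simp]: "admissible (mult_op (\<lambda>x. V (norm x)))"
  by (simp add: smooth_on_comp_norm V)

lemma radial_radial_mult: "E.radial (radial_mult V)"
  unfolding E.radial_def
  using partial_comp_norm[OF V] commute_radial_mult_sigma commute_radial_mult_mult_op[OF smooth_on_nth]
  by (auto simp: xs_def pos_def intro: commute_add)

lemma commute_radial_mult:
  assumes "z \<in> {E.\<kappa>, E.a, E.y, E.Q}"
  shows "commute (radial_mult V) z"
proof -
  have "commute (radial_mult V) rho"
    unfolding rho_def by (rule commute_radial_mult_mult_op[OF smooth_on_inverse_norm])
  moreover have "commute (radial_mult V) E.a" "commute (radial_mult V) E.X"
    "commute (radial_mult V) E.q" "commute (radial_mult V) E.\<kappa>"
    using E.radial_a[OF radial_radial_mult] E.radial_X[OF radial_radial_mult] E.radial_q[OF radial_radial_mult]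
    by (auto simp: commute_def[of "radial_mult V" E.a] commute_def[of "radial_mult V" E.X]
        commute_def[of "radial_mult V" E.q]
        E.\<kappa>_def intro: commute_dot commute_radial_mult_sigma)
  ultimately show ?thesis
    using assms by (auto simp: E.y_def E.Q_def intro: commute_mult)
qed

end

lemma endo_of_spin_orbit_weight:
  "smooth_on punctured (\<lambda>x. hbar / (2 * (norm x)\<^sup>2))"
  "endo_of (mult_op (\<lambda>x. hbar / (2 * (norm x)\<^sup>2))) = sc (of_real hbar / 2) * (rho * rho)"
proof -
  have eq: "hbar / (2 * (norm x)\<^sup>2) = hbar / 2 * (1 / norm x * (1 / norm x))" for x :: "real ^ 3"
    by (simp add: power2_eq_square)
  note s = smooth_on_mult[OF open_punctured smooth_on_inverse_norm smooth_on_inverse_norm]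
    smooth_on_const[OF open_punctured]
  show "smooth_on punctured (\<lambda>x. hbar / (2 * (norm x)\<^sup>2))"
    unfolding eq by (rule smooth_on_mult[OF open_punctured s(2,1)])
  show "endo_of (mult_op (\<lambda>x. hbar / (2 * (norm x)\<^sup>2))) = sc (of_real hbar / 2) * (rho * rho)"
    unfolding eq endo_of_mult_op_mult[OF s(2,1), symmetric] endo_of_mult_op_const rho_def
      endo_of_mult_op_mult[OF smooth_on_inverse_norm smooth_on_inverse_norm, symmetric]
    by simp
qed

text \<open>Since \<open>op_A\<close> carries one factor \<open>hbar\<close> and its weight
  \<open>hbar / 2\<close>, the spin-orbit term has the coefficient of the kinetic term with opposite
  sign, and the two merge into \<open>E.c\<close>. The sign before \<open>radial_mult V2\<close>
  comes from \<open>endo_of_K\<close>.\<close>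

lemma
  assumes V0: "smooth_on {0<..} V0" and V2: "smooth_on {0<..} V2"
  shows admissible_hamiltonian: "admissible (hamiltonian hbar V0 V2)"
    and endo_of_hamiltonian: "endo_of (hamiltonian hbar V0 V2) =
      sc (- (of_real hbar)\<^sup>2 / 2) * (rho * rho * (E.D * E.D + E.D + E.c))
      + radial_mult V0 - radial_mult V2 * E.\<kappa>"
proof -
  have adm [simp]: "admissible (mult_op (\<lambda>x. hbar / (2 * (norm x)\<^sup>2)))"
    by (rule admissible_mult_op[OF endo_of_spin_orbit_weight(1)])
  have eq: "hamiltonian hbar V0 V2 = of_real (- hbar\<^sup>2 / 2) \<cdot> op_inner partial partial
     + mult_op (\<lambda>x. V0 (norm x)) + mult_op (\<lambda>x. hbar / (2 * (norm x)\<^sup>2)) \<odot> op_A hbar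
     + mult_op (\<lambda>x. V2 (norm x)) \<odot> op_K"
    by (simp only: hamiltonian_def op_A_def op_K_def)
  note [simp] = admissible_mult_op_comp_norm[OF V0] admissible_mult_op_comp_norm[OF V2]
  show "admissible (hamiltonian hbar V0 V2)"
    unfolding eq by (simp del: admissible_mult_op)
  have "endo_of (hamiltonian hbar V0 V2) = sc (of_real (- hbar\<^sup>2 / 2)) * dot ds ds
     + radial_mult V0 + sc (of_real hbar / 2) * (rho * rho) * (sc (of_real hbar) * E.a)
     - radial_mult V2 * E.\<kappa>"
    unfolding eq
    by (simp add: endo_of_plus endo_of_comp endo_of_op_scale endo_of_op_inner endo_of_K endo_of_A
        endo_of_spin_orbit_weight(2) ds_def[symmetric] del: admissible_mult_op)
  also have "sc (of_real hbar / 2) * (rho * rho) * (sc (of_real hbar) * E.a)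
      = - (sc (- (of_real hbar)\<^sup>2 / 2) * (rho * rho * E.a))"
    by (simp add: mult.assoc sc_left[of rho] sc_sc sc_minus power2_eq_square)
  finally show "endo_of (hamiltonian hbar V0 V2) =
      sc (- (of_real hbar)\<^sup>2 / 2) * (rho * rho * (E.D * E.D + E.D + E.c))
      + radial_mult V0 - radial_mult V2 * E.\<kappa>"
    by (simp add: E.laplace E.c_def distrib_left right_diff_distrib)
qed

lemma commute_hamiltonian:
  assumes V0: "smooth_on {0<..} V0" and V2: "smooth_on {0<..} V2"
    and z: "z \<in> {E.\<kappa>, E.a, E.y, E.Q}"
  shows "commute (endo_of (hamiltonian hbar V0 V2)) z"
proof -
  have \<kappa>: "commute z E.\<kappa>"
    using z E.commute_\<kappa> by (auto intro: commute_sym)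
  have F: "commute z (endo_of (mult_op (\<lambda>x. V (norm x))))" if "smooth_on {0<..} V" for V
    by (rule commute_sym[OF commute_radial_mult[OF that z]])
  have E: "commute z (sc b * (rho * rho * (E.D * E.D + E.D + E.c)))" for b
    by (rule commute_mult[OF commute_sc(2) commute_sym[OF E.commute_energy[OF z]]])
  show ?thesis
    unfolding endo_of_hamiltonian[OF V0 V2]
    by (rule commute_sym[OF commute_diff[OF commute_add[OF E F[OF V0]] commute_mult[OF F[OF V2] \<kappa>]]])
qed

section \<open>Relations between the integrals of motion\<close>

lemma L2_eq:
  "op_L2 hbar \<doteq> op_J2 hbar - of_real hbar \<cdot> op_A hbar - of_real (hbar\<^sup>2 / 4) \<cdot> (6 \<cdot> id + 2 \<cdot> op_K)"
proof (rule op_eqI)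
  let ?h = "of_real hbar :: complex"
  have four: "sc (?h * ?h / 4) * (4 * T) = sc (?h * ?h) * T" for T
    unfolding sc_numeral[symmetric] sc_sc by simp
  show "endo_of (op_L2 hbar) = endo_of (op_J2 hbar - of_real hbar \<cdot> op_A hbar
      - of_real (hbar\<^sup>2 / 4) \<cdot> (6 \<cdot> id + 2 \<cdot> op_K))"
    by (simp add: endo_of_diff endo_of_plus endo_of_op_scale endo_of_L2 endo_of_J2 endo_of_A endo_of_K endo_of_id
        distrib_left right_diff_distrib four sc_sc sc_minus sc_numeral power2_eq_square mult.assoc)
qed simp_all

lemma Y9_eq: "op_Y9 hbar \<doteq> - (op_Y8 \<odot> op_A hbar) + \<i> \<cdot> op_Y10 hbar - of_real hbar \<cdot> op_Y8"
  by (rule op_eqI)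
    (simp_all add: endo_of_diff endo_of_plus endo_of_uminus endo_of_comp endo_of_op_scale endo_of_A endo_of_Y8
      endo_of_Y9 endo_of_Y10 distrib_left right_diff_distrib sc_left[of E.y] mult.assoc sc_sc sc_minus mult.commute[of \<i>])

lemma commutator_A_Y8: "commutator (op_A hbar) op_Y8 \<doteq> (- 2 * \<i>) \<cdot> op_Y10 hbar"
proof (rule op_eqI)
  have "endo_of (commutator (op_A hbar) op_Y8) = sc (\<i> * of_real hbar) * (E.a * E.y - E.y * E.a)"
    by (simp add: endo_of_commutator endo_of_A endo_of_Y8 right_diff_distrib sc_left[of E.y] sc_left[of E.a]
        mult.assoc sc_sc mult.commute[of \<i>])
  also have "\<dots> = endo_of ((- 2 * \<i>) \<cdot> op_Y10 hbar)"
    unfolding E.a_y by (simp add: endo_of_op_scale endo_of_Y10 sc_sc sc_minus mult_ac flip: sc_numeral)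
  finally show "endo_of (commutator (op_A hbar) op_Y8) = endo_of ((- 2 * \<i>) \<cdot> op_Y10 hbar)" .
qed simp_all

lemma commutator_Y8_Y10: "commutator op_Y8 (op_Y10 hbar) \<doteq>
    (- 2 * \<i>) \<cdot> op_A hbar - (\<i> * of_real hbar) \<cdot> (6 \<cdot> id + 2 \<cdot> op_K - op_Y8 \<odot> op_Y8)"
proof (rule op_eqI)
  have "endo_of (commutator op_Y8 (op_Y10 hbar)) = sc (\<i> * of_real hbar) * (E.y * E.Q - E.Q * E.y)"
    by (simp add: endo_of_commutator endo_of_Y10 endo_of_Y8 right_diff_distrib sc_left[of E.y] sc_left[of E.Q]
        mult.assoc sc_sc mult.commute[of \<i>])
  also have "\<dots> = endo_of ((- 2 * \<i>) \<cdot> op_A hbar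
      - (\<i> * of_real hbar) \<cdot> (6 \<cdot> id + 2 \<cdot> op_K - op_Y8 \<odot> op_Y8))"
    unfolding E.y_Q
    by (simp add: endo_of_diff endo_of_plus endo_of_comp endo_of_op_scale endo_of_A endo_of_Y8 endo_of_K
        endo_of_id distrib_left right_diff_distrib sc_left[of E.y] mult.assoc sc_sc sc_minus mult_ac
        flip: sc_numeral)
  finally show "endo_of (commutator op_Y8 (op_Y10 hbar)) = endo_of ((- 2 * \<i>) \<cdot> op_A hbar
      - (\<i> * of_real hbar) \<cdot> (6 \<cdot> id + 2 \<cdot> op_K - op_Y8 \<odot> op_Y8))" .
qed simp_all

lemma commutator_A_Y10: "commutator (op_A hbar) (op_Y10 hbar) \<doteq>
    (2 * \<i>) \<cdot> (op_Y8 \<odot> op_L2 hbar) - of_real (2 * hbar) \<cdot> op_Y10 hbar"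
proof (rule op_eqI)
  have "endo_of (commutator (op_A hbar) (op_Y10 hbar)) = sc ((of_real hbar)\<^sup>2) * (E.a * E.Q - E.Q * E.a)"
    by (simp add: endo_of_commutator endo_of_Y10 endo_of_A right_diff_distrib sc_left[of E.a] sc_left[of E.Q]
        mult.assoc sc_sc power2_eq_square)
  also have "\<dots> = endo_of ((2 * \<i>) \<cdot> (op_Y8 \<odot> op_L2 hbar) - of_real (2 * hbar) \<cdot> op_Y10 hbar)"
    unfolding E.a_Q
    by (simp add: endo_of_diff endo_of_comp endo_of_op_scale endo_of_L2 endo_of_Y8 endo_of_Y10
        right_diff_distrib sc_left[of E.y] mult.assoc sc_sc sc_minus power2_eq_square mult_ac flip: sc_numeral)
  finally show "endo_of (commutator (op_A hbar) (op_Y10 hbar)) =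
      endo_of ((2 * \<i>) \<cdot> (op_Y8 \<odot> op_L2 hbar) - of_real (2 * hbar) \<cdot> op_Y10 hbar)" .
qed simp_all

lemma commute_numeral: "commute T (numeral n :: endo)"
  by (simp flip: sc_numeral)

text \<open>By \<open>endo_of_J2\<close>, the squared total angular momentum is a scalar multiple of
  \<open>4 * E.c + (2 * E.\<kappa> - 6)\<close>.\<close>

lemma commute_J2:
  assumes "z \<in> {E.\<kappa>, E.a, E.y, E.Q}"
  shows "commute z (endo_of (op_J2 hbar))"
proof -
  have "commute z E.c" "commute z E.\<kappa>"
    using assms E.commute_c E.commute_\<kappa> by (auto intro: commute_sym)
  then have "commute z (4 * E.c + (2 * E.\<kappa> - 6))"
    by (intro commute_add commute_diff commute_mult commute_numeral)
  then show ?thesis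
    unfolding endo_of_J2 by (intro commute_mult commute_sc) (simp add: E.c_def right_diff_distrib)
qed

lemma integral_of_motionI:
  assumes "smooth_on {0<..} V0" "smooth_on {0<..} V2" "admissible T"
    and "commute (endo_of (hamiltonian hbar V0 V2)) (endo_of T)"
  shows "integral_of_motion (hamiltonian hbar V0 V2) T"
  unfolding integral_of_motion_def
  by (rule commutator_eq_0[OF admissible_hamiltonian[OF assms(1,2)] assms(3,4)])

section \<open>Quadratic closure\<close>

lemma op_scale_id_comp: "(c \<cdot> id) \<odot> T = c \<cdot> T"
  by (simp add: op_scale_def fun_eq_iff)

lemma zero_in_op_polynomials: "0 \<in> op_polynomials Z"
  using op_polynomials.const[of 0 Z] by (simp add: op_scale_def zero_fun_def)

lemma scale_in_op_polynomials: "T \<in> op_polynomials Z \<Longrightarrow> c \<cdot> T \<in> op_polynomials Z"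
  using op_polynomials.mult[OF op_polynomials.const] by (metis op_scale_id_comp)

text \<open>The condition of \<open>closes_quadratically\<close> for a single operator
  \<open>W\<close>, isolated so that it can be transported to \<open>- W\<close> and hence to the
  reversed commutator.\<close>

definition quadratic :: "spinor_op set \<Rightarrow> spinor_op list \<Rightarrow> spinor_op \<Rightarrow> bool" where
  "quadratic Z Gs W \<longleftrightarrow> (\<exists>c0 c1 c2.
        c0 \<in> op_polynomials Z \<and>
        (\<forall>i<length Gs. c1 i \<in> op_polynomials Z) \<and>
        (\<forall>i<length Gs. \<forall>j<length Gs. c2 i j \<in> op_polynomials Z) \<and>
        W \<doteq> c0 + (\<Sum>i<length Gs. c1 i \<odot> Gs ! i)
             + (\<Sum>i<length Gs. \<Sum>j<length Gs. c2 i j \<odot> Gs ! i \<odot> Gs ! j))"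

lemma op_uminus_comp: "- T \<odot> U = - (T \<odot> U)" for T U :: spinor_op
  by (simp add: fun_eq_iff)

lemma quadratic_uminus:
  assumes "quadratic Z Gs W"
  shows "quadratic Z Gs (- W)"
proof -
  obtain c0 c1 c2 where c: "c0 \<in> op_polynomials Z" "\<And>i. i < length Gs \<Longrightarrow> c1 i \<in> op_polynomials Z"
      "\<And>i j. i < length Gs \<Longrightarrow> j < length Gs \<Longrightarrow> c2 i j \<in> op_polynomials Z"
    and W: "W \<doteq> c0 + (\<Sum>i<length Gs. c1 i \<odot> Gs ! i)
             + (\<Sum>i<length Gs. \<Sum>j<length Gs. c2 i j \<odot> Gs ! i \<odot> Gs ! j)"
    using assms unfolding quadratic_def by blast
  have "- W \<doteq> - c0 + (\<Sum>i<length Gs. - c1 i \<odot> Gs ! i)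
             + (\<Sum>i<length Gs. \<Sum>j<length Gs. - c2 i j \<odot> Gs ! i \<odot> Gs ! j)"
    using W by (simp add: op_eq_def op_uminus_comp sum_negf)
  then show ?thesis
    unfolding quadratic_def
    by (intro exI[of _ "- c0"] exI[of _ "\<lambda>i. - c1 i"] exI[of _ "\<lambda>i j. - c2 i j"])
       (simp add: c op_uminus_eq[of c0] op_uminus_eq[of "c1 _"] op_uminus_eq[of "c2 _ _"] scale_in_op_polynomials)
qed

lemma commutator_swap: "commutator U T = - commutator T U"
  by (simp add: commutator_def)

lemma op_zero_comp: "0 \<odot> T = 0" for T :: spinor_op
  by (simp add: fun_eq_iff)

text \<open>Of the nine ordered quadratic monomials only \<open>U \<odot> T\<close> and
  \<open>U \<odot> U\<close> are allowed: the eighth operator times \<open>op_A\<close> and the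
  square of the eighth cover all the commutators in question.\<close>

lemma quadratic_three:
  assumes "{c0, c10, c11, c12, c210, c211} \<subseteq> op_polynomials Z"
    and "W \<doteq> c0 + (c10 \<odot> T + c11 \<odot> U + c12 \<odot> V) + (c210 \<odot> U \<odot> T + c211 \<odot> U \<odot> U)"
  shows "quadratic Z [T, U, V] W"
  unfolding quadratic_def
proof (intro exI conjI)
  let ?c1 = "\<lambda>i::nat. if i = 0 then c10 else if i = 1 then c11 else c12"
  let ?c2 = "\<lambda>i j::nat. if i = 1 \<and> j = 0 then c210 else if i = 1 \<and> j = 1 then c211 else 0"
  show "c0 \<in> op_polynomials Z" "\<forall>i<length [T, U, V]. ?c1 i \<in> op_polynomials Z"
    "\<forall>i<length [T, U, V]. \<forall>j<length [T, U, V]. ?c2 i j \<in> op_polynomials Z"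
    using assms(1) zero_in_op_polynomials by auto
  show "W \<doteq> c0 + (\<Sum>i<length [T, U, V]. ?c1 i \<odot> [T, U, V] ! i)
      + (\<Sum>i<length [T, U, V]. \<Sum>j<length [T, U, V]. ?c2 i j \<odot> [T, U, V] ! i \<odot> [T, U, V] ! j)"
    using assms(2) by (simp add: eval_nat_numeral op_zero_comp add.assoc)
qed

lemma op_eq_trans: "T \<doteq> U \<Longrightarrow> U \<doteq> V \<Longrightarrow> T \<doteq> V"
  by (simp add: op_eq_def)

lemma generators_close_quadratically:
  "closes_quadratically {op_K, op_J2 hbar} [op_A hbar, op_Y8, op_Y10 hbar]"
proof -
  let ?Z = "{op_K, op_J2 hbar}" and ?G = "[op_A hbar, op_Y8, op_Y10 hbar]"
  let ?P = "op_polynomials ?Z"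
  have const: "c \<cdot> id \<in> ?P" and K: "op_K \<in> ?P" and J: "op_J2 hbar \<in> ?P" for c
    by (auto intro: op_polynomials.intros)
  note poly = const K J zero_in_op_polynomials scale_in_op_polynomials op_polynomials.add
  have self: "quadratic ?Z ?G (commutator T T)" for T
    by (rule quadratic_three[of 0 0 0 0 0 0])
      (simp_all add: zero_in_op_polynomials commutator_def op_zero_comp op_eq_def)
  have AY: "quadratic ?Z ?G (commutator (op_A hbar) op_Y8)"
    by (rule quadratic_three[of 0 0 0 "(- 2 * \<i>) \<cdot> id" 0 0])
      (use commutator_A_Y8[of hbar] in \<open>simp_all add: poly op_zero_comp op_scale_id_comp\<close>)
  have YZ: "quadratic ?Z ?G (commutator op_Y8 (op_Y10 hbar))"
  proof (rule quadratic_three)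
    let ?c = "\<i> * of_real hbar"
    \<comment> \<open>The coefficients come from multiplying out \<open>commutator_Y8_Y10\<close>;
      the square of \<open>op_Y8\<close> is the only quadratic term.\<close>
    show "{(- 6 * ?c) \<cdot> id + (- 2 * ?c) \<cdot> op_K, (- 2 * \<i>) \<cdot> id, 0, 0, 0, ?c \<cdot> id} \<subseteq> ?P"
      by (simp add: poly)
    show "commutator op_Y8 (op_Y10 hbar) \<doteq> ((- 6 * ?c) \<cdot> id + (- 2 * ?c) \<cdot> op_K)
      + (((- 2 * \<i>) \<cdot> id) \<odot> op_A hbar + 0 \<odot> op_Y8 + 0 \<odot> op_Y10 hbar)
      + (0 \<odot> op_Y8 \<odot> op_A hbar + (?c \<cdot> id) \<odot> op_Y8 \<odot> op_Y8)"
    proof (rule op_eq_trans[OF commutator_Y8_Y10], rule op_eqI)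
      show "endo_of ((- 2 * \<i>) \<cdot> op_A hbar - ?c \<cdot> (6 \<cdot> id + 2 \<cdot> op_K - op_Y8 \<odot> op_Y8)) =
        endo_of (((- 6 * ?c) \<cdot> id + (- 2 * ?c) \<cdot> op_K)
      + (((- 2 * \<i>) \<cdot> id) \<odot> op_A hbar + 0 \<odot> op_Y8 + 0 \<odot> op_Y10 hbar)
      + (0 \<odot> op_Y8 \<odot> op_A hbar + (?c \<cdot> id) \<odot> op_Y8 \<odot> op_Y8))"
        by (simp add: endo_of_plus endo_of_diff endo_of_comp endo_of_op_scale endo_of_id endo_of_0
            distrib_left right_diff_distrib sc_sc sc_minus mult_ac)
    qed simp_all
  qed
  have AZ: "quadratic ?Z ?G (commutator (op_A hbar) (op_Y10 hbar))"
  proof (rule quadratic_three)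
    let ?h = "of_real hbar :: complex"
    \<comment> \<open>Inserting \<open>L2_eq\<close> into \<open>commutator_A_Y10\<close> and moving
      the central elements to the left of \<open>op_Y8\<close> gives this coefficient; the part of
      \<open>op_L2\<close> proportional to \<open>op_A\<close> gives the quadratic term.\<close>
    let ?c11 = "(2 * \<i>) \<cdot> op_J2 hbar + (- 3 * \<i> * ?h\<^sup>2) \<cdot> id + (- \<i> * ?h\<^sup>2) \<cdot> op_K"
    show "{0, 0, ?c11, (- 2 * ?h) \<cdot> id, (- 2 * \<i> * ?h) \<cdot> id, 0} \<subseteq> ?P"
      by (simp add: poly)
    show "commutator (op_A hbar) (op_Y10 hbar) \<doteq> 0
      + (0 \<odot> op_A hbar + ?c11 \<odot> op_Y8 + ((- 2 * ?h) \<cdot> id) \<odot> op_Y10 hbar)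
      + (((- 2 * \<i> * ?h) \<cdot> id) \<odot> op_Y8 \<odot> op_A hbar + 0 \<odot> op_Y8 \<odot> op_Y8)"
    proof (rule op_eq_trans[OF commutator_A_Y10], rule op_eqI)
      have L: "endo_of (op_L2 hbar) = endo_of (op_J2 hbar) - sc ?h * endo_of (op_A hbar)
          - sc (?h\<^sup>2 / 4) * (sc 6 + sc 2 * endo_of op_K)"
        using endo_of_cong[OF _ _ L2_eq, of hbar]
        by (simp add: endo_of_diff endo_of_plus endo_of_op_scale endo_of_id)
      have c: "endo_of op_Y8 * endo_of (op_J2 hbar) = endo_of (op_J2 hbar) * endo_of op_Y8"
        "endo_of op_Y8 * endo_of op_K = endo_of op_K * endo_of op_Y8"
        using commute_J2[of E.y hbar] E.commute_\<kappa>
        by (simp_all add: endo_of_Y8 endo_of_K sc_left[of "endo_of _"] sc_left[of "E.\<kappa>"] mult.assoc commute_def)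
      have s: "?h\<^sup>2 / 4 * 6 * (2 * \<i>) = 3 * \<i> * ?h\<^sup>2" "?h\<^sup>2 / 4 * 2 * (2 * \<i>) = \<i> * ?h\<^sup>2"
        by simp_all
      show "endo_of ((2 * \<i>) \<cdot> (op_Y8 \<odot> op_L2 hbar) - of_real (2 * hbar) \<cdot> op_Y10 hbar) = endo_of (0
      + (0 \<odot> op_A hbar + ?c11 \<odot> op_Y8 + ((- 2 * ?h) \<cdot> id) \<odot> op_Y10 hbar)
      + (((- 2 * \<i> * ?h) \<cdot> id) \<odot> op_Y8 \<odot> op_A hbar + 0 \<odot> op_Y8 \<odot> op_Y8))"
        by (simp add: endo_of_plus endo_of_diff endo_of_comp endo_of_op_scale endo_of_id endo_of_0 L c
            distrib_left distrib_right right_diff_distrib left_diff_distrib endo_of_sc sc_sc sc_minus mult.assoc s)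
    qed simp_all
  qed
  have swap: "quadratic ?Z ?G (commutator U T)" if "quadratic ?Z ?G (commutator T U)" for T U
    using quadratic_uminus[OF that] by (simp add: commutator_swap[of U T])
  show ?thesis
    using self AY YZ AZ swap[OF AY] swap[OF YZ] swap[OF AZ]
    unfolding closes_quadratically_def quadratic_def[symmetric] by simp
qed

theorem proposition4:
  fixes hbar :: real and V0 V2 :: "real \<Rightarrow> real"
  assumes "hbar > 0"
    and "smooth_on {0<..} V0" and "smooth_on {0<..} V2"
  shows
    "integral_of_motion (hamiltonian hbar V0 V2) op_K \<and>
     integral_of_motion (hamiltonian hbar V0 V2) (op_A hbar) \<and>
     integral_of_motion (hamiltonian hbar V0 V2) op_Y8 \<and>
     integral_of_motion (hamiltonian hbar V0 V2) (op_Y9 hbar) \<and>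
     integral_of_motion (hamiltonian hbar V0 V2) (op_Y10 hbar) \<and>

     commutator op_K (op_A hbar) \<doteq> 0 \<and>
     commutator op_K op_Y8 \<doteq> 0 \<and>
     commutator op_K (op_Y10 hbar) \<doteq> 0 \<and>
     commutator op_K (op_J2 hbar) \<doteq> 0 \<and>
     commutator (op_J2 hbar) (op_A hbar) \<doteq> 0 \<and>
     commutator (op_J2 hbar) op_Y8 \<doteq> 0 \<and>
     commutator (op_J2 hbar) (op_Y10 hbar) \<doteq> 0 \<and>

     op_Y9 hbar \<doteq> - (op_Y8 \<odot> op_A hbar) + \<i> \<cdot> op_Y10 hbar - of_real hbar \<cdot> op_Y8 \<and>

     commutator (op_A hbar) op_Y8 \<doteq> (- 2 * \<i>) \<cdot> op_Y10 hbar \<and>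
     commutator op_Y8 (op_Y10 hbar) \<doteq>
       (- 2 * \<i>) \<cdot> op_A hbar
       - (\<i> * of_real hbar) \<cdot> (6 \<cdot> id + 2 \<cdot> op_K - op_Y8 \<odot> op_Y8) \<and>
     commutator (op_A hbar) (op_Y10 hbar) \<doteq>
       (2 * \<i>) \<cdot> (op_Y8 \<odot> op_L2 hbar) - of_real (2 * hbar) \<cdot> op_Y10 hbar \<and>
     op_L2 hbar \<doteq>
       op_J2 hbar - of_real hbar \<cdot> op_A hbar - of_real (hbar\<^sup>2 / 4) \<cdot> (6 \<cdot> id + 2 \<cdot> op_K) \<and>

     closes_quadratically {op_K, op_J2 hbar} [op_A hbar, op_Y8, op_Y10 hbar]"
proof (intro conjI)
  note H = commute_hamiltonian[OF assms(2,3), of _ hbar]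
  note iom = integral_of_motionI[OF assms(2,3)]
  \<comment> \<open>All five images are built from the four elements \<open>E.\<kappa>\<close>,
    \<open>E.a\<close>, \<open>E.y\<close>, \<open>E.Q\<close> and scalars, so commuting with these
    four suffices.\<close>
  have gen: "commute T (endo_of op_K)" "commute T (endo_of (op_A hbar))" "commute T (endo_of op_Y8)"
    "commute T (endo_of (op_Y9 hbar))" "commute T (endo_of (op_Y10 hbar))"
    if "\<And>z. z \<in> {E.\<kappa>, E.a, E.y, E.Q} \<Longrightarrow> commute T z" for T
    unfolding endo_of_K endo_of_A endo_of_Y8 endo_of_Y9 endo_of_Y10 mult_minus_left
    by (intro commute_uminus commute_mult commute_add commute_diff commute_sc that; simp)+
  show "integral_of_motion (hamiltonian hbar V0 V2) op_K"
    "integral_of_motion (hamiltonian hbar V0 V2) (op_A hbar)"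
    "integral_of_motion (hamiltonian hbar V0 V2) op_Y8"
    "integral_of_motion (hamiltonian hbar V0 V2) (op_Y9 hbar)"
    "integral_of_motion (hamiltonian hbar V0 V2) (op_Y10 hbar)"
    by (rule iom, simp, rule gen, rule H, assumption)+
  have K: "commute (endo_of op_K) z" if "z \<in> {E.\<kappa>, E.a, E.y, E.Q}" for z
    unfolding endo_of_K using that E.commute_\<kappa> by (auto intro!: commute_sym[OF commute_uminus] intro: commute_sym)
  have J: "commute (endo_of (op_J2 hbar)) z" if "z \<in> {E.\<kappa>, E.a, E.y, E.Q}" for z
    by (rule commute_sym[OF commute_J2[OF that]])
  show "commutator op_K (op_A hbar) \<doteq> 0" "commutator op_K op_Y8 \<doteq> 0" "commutator op_K (op_Y10 hbar) \<doteq> 0"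
    by (rule commutator_eq_0, simp, simp, rule gen, rule K, assumption)+
  show "commutator (op_J2 hbar) (op_A hbar) \<doteq> 0" "commutator (op_J2 hbar) op_Y8 \<doteq> 0"
    "commutator (op_J2 hbar) (op_Y10 hbar) \<doteq> 0"
    by (rule commutator_eq_0, simp, simp, rule gen, rule J, assumption)+
  \<comment> \<open>Here \<open>op_J2\<close> takes the role of \<open>T\<close> in
    \<open>gen\<close>, so the commutation is reversed first.\<close>
  show "commutator op_K (op_J2 hbar) \<doteq> 0"
    by (rule commutator_eq_0, simp, simp, rule commute_sym, rule gen, rule J, assumption)
qed (fact L2_eq Y9_eq commutator_A_Y8 commutator_Y8_Y10 commutator_A_Y10 generators_close_quadratically)+

end
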